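(* Let $(x_\alpha)_{\alpha\in\Gamma}$ be a net in a von Neumann algebra $\mathcal{M}$, let $x\in\mathcal{M}$, and let $\preceq$ be the star order on $\mathcal{M}$. If $(x_\alpha)_{\alpha\in\Gamma}$ is order convergent to $x$ in $(\mathcal{M},\preceq)$, then $(x_\alpha)_{\alpha\in\Gamma}$ converges to $x$ in the $\sigma$-strong* topology $s^*(\mathcal{M},\mathcal{M}_* )$. In particular, $s^*(\mathcal{M},\mathcal{M}_* )\subseteq \tau_o(\mathcal{M},\preceq)$.
   Context: A von Neumann algebra is a strongly closed C*-subalgebra of the C*-algebra $\mathscr{B}(\mathscr{H})$ of all bounded operators on a complex Hilbert space $\mathscr{H}$. The star order on $\mathcal{M}$ is the partial order defined by $x\preceq y$ if and only if $x^*x=x^*y$ and $xx^*=yx^*$. $\mathcal{M}_*$ denotes the predual of $\mathcal{M}$, consisting of the normal linear functionals in $\mathcal{M}^*$. The $\sigma$-strong* topology $s^*(\mathcal{M},\mathcal{M}_* )$ is the topology on $\mathcal{M}$ defined by the semi-norms $x\mapsto\sqrt{\varphi(x^*x)+\varphi(xx^* )}$, where $\varphi\in\mathcal{M}_*$ is positive. Order convergence and order topology: let $(P,\leq)$ be a poset. A net $(x_\alpha)_{\alpha\in\Gamma}$ in $P$ is order convergent to $x\in P$ in $(P,\leq)$ if there are nets $(y_\alpha)_{\alpha\in\Gamma}$ and $(z_\alpha)_{\alpha\in\Gamma}$ in $P$ (with the same index set) such that $y_\alpha\leq x_\alpha\leq z_\alpha$ for all $\alpha\in\Gamma$, $(y_\alpha)$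 is increasing with supremum $x$ in $P$, and $(z_\alpha)$ is decreasing with infimum $x$ in $P$. A subset $C\subseteq P$ is order closed if no net in $C$ is order convergent to a point of $P\setminus C$. The order topology $\tau_o(P,\leq)$ is the topology on $P$ whose closed sets are exactly the order closed sets. *)

theory Defs
  imports "HOL-Analysis.Analysis"
begin

section \<open>Nets, order convergence and the order topology\<close>

text \<open>A poset is given by a carrier \<open>P\<close> and a relation \<open>le\<close>, of which only the restriction to
  \<open>P\<close> matters; a directed index set is given in the same way.\<close>

definition poset :: "'a set \<Rightarrow> ('a \<Rightarrow> 'a \<Rightarrow> bool) \<Rightarrow> bool" where
  "poset P le \<longleftrightarrow> reflp_on P le \<and> transp_on P le \<and> antisymp_on P le"

definition directed_set :: "'i set \<Rightarrow> ('i \<Rightarrow> 'i \<Rightarrow> bool) \<Rightarrow> bool" where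
  "directed_set I r \<longleftrightarrow>
     I \<noteq> {} \<and> reflp_on I r \<and> transp_on I r \<and> (\<forall>i\<in>I. \<forall>j\<in>I. \<exists>k\<in>I. r i k \<and> r j k)"

definition net_filter :: "'i set \<Rightarrow> ('i \<Rightarrow> 'i \<Rightarrow> bool) \<Rightarrow> 'i filter" where
  "net_filter I r = (INF i\<in>I. principal {j\<in>I. r i j})"

definition is_supremum :: "'a set \<Rightarrow> ('a \<Rightarrow> 'a \<Rightarrow> bool) \<Rightarrow> 'a set \<Rightarrow> 'a \<Rightarrow> bool" where
  "is_supremum P le S x \<longleftrightarrow>
     x \<in> P \<and> (\<forall>s\<in>S. le s x) \<and> (\<forall>u\<in>P. (\<forall>s\<in>S. le s u) \<longrightarrow> le x u)"

definition is_infimum :: "'a set \<Rightarrow> ('a \<Rightarrow> 'a \<Rightarrow> bool) \<Rightarrow> 'a set \<Rightarrow> 'a \<Rightarrow> bool" where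
  "is_infimum P le S x \<longleftrightarrow>
     x \<in> P \<and> (\<forall>s\<in>S. le x s) \<and> (\<forall>u\<in>P. (\<forall>s\<in>S. le u s) \<longrightarrow> le u x)"

definition order_convergent ::
  "'a set \<Rightarrow> ('a \<Rightarrow> 'a \<Rightarrow> bool) \<Rightarrow> 'i set \<Rightarrow> ('i \<Rightarrow> 'i \<Rightarrow> bool) \<Rightarrow> ('i \<Rightarrow> 'a) \<Rightarrow> 'a \<Rightarrow> bool" where
  "order_convergent P le I r X x \<longleftrightarrow>
     (\<exists>Y Z. Y ` I \<subseteq> P \<and> Z ` I \<subseteq> P \<and>
        (\<forall>i\<in>I. le (Y i) (X i) \<and> le (X i) (Z i)) \<and>
        monotone_on I r le Y \<and> is_supremum P le (Y ` I) x \<and>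
        monotone_on I r (\<lambda>a b. le b a) Z \<and> is_infimum P le (Z ` I) x)"

text \<open>HOL cannot quantify over the types of index sets inside a definition, so the nets below are
  indexed by directed subsets of \<open>'a \<times> 'a \<times> 'a\<close>. This loses nothing: lemma
  \<open>order_closed_any_net\<close> shows that the resulting sets are closed under order limits of
  nets with arbitrary index type (index \<open>x\<^sub>i\<close> by the triple \<open>(y\<^sub>i, x\<^sub>i, z\<^sub>i)\<close>).\<close>

definition order_closed :: "'a set \<Rightarrow> ('a \<Rightarrow> 'a \<Rightarrow> bool) \<Rightarrow> 'a set \<Rightarrow> bool" where
  "order_closed P le C \<longleftrightarrow> C \<subseteq> P \<and>
     \<not> (\<exists>(I :: ('a \<times> 'a \<times> 'a) set) r X x.
          directed_set I r \<and> X ` I \<subseteq> C \<and> x \<in> P - C \<and> order_convergent P le I r X x)"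

definition order_topology :: "'a set \<Rightarrow> ('a \<Rightarrow> 'a \<Rightarrow> bool) \<Rightarrow> 'a topology" where
  "order_topology P le = topology (\<lambda>U. U \<subseteq> P \<and> order_closed P le (P - U))"

lemma eventually_net_filter:
  assumes "directed_set I r"
  shows "eventually Q (net_filter I r) \<longleftrightarrow> (\<exists>i\<in>I. \<forall>j\<in>I. r i j \<longrightarrow> Q j)"
proof -
  have "eventually Q (net_filter I r) \<longleftrightarrow> (\<exists>i\<in>I. eventually Q (principal {j\<in>I. r i j}))"
    unfolding net_filter_def
  proof (rule eventually_INF_base)
    show "I \<noteq> {}" using assms by (simp add: directed_set_def)
    fix a b assume ab: "a \<in> I" "b \<in> I"
    then obtain k where k: "k \<in> I" "r a k" "r b k"
      using assms by (auto simp: directed_set_def)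
    have tr: "transp_on I r" using assms by (simp add: directed_set_def)
    have "{j\<in>I. r k j} \<subseteq> {j\<in>I. r a j} \<inter> {j\<in>I. r b j}"
      using k ab transp_onD[OF tr] by blast
    then show "\<exists>x\<in>I. principal {j\<in>I. r x j} \<le> inf (principal {j\<in>I. r a j}) (principal {j\<in>I. r b j})"
      using k(1) by auto
  qed
  then show ?thesis by (auto simp: eventually_principal)
qed

lemma order_closed_any_net:
  fixes I :: "'i set" and P :: "'a set" and X :: "'i \<Rightarrow> 'a"
  assumes po: "poset P le" and C: "order_closed P le C"
    and I: "directed_set I r" and X: "X ` I \<subseteq> C" and x: "order_convergent P le I r X x"
  shows "x \<in> C"
proof (rule ccontr)
  assume xC: "x \<notin> C"
  obtain Y Z where YZ: "Y ` I \<subseteq> P" "Z ` I \<subseteq> P" "\<forall>i\<in>I. le (Y i) (X i) \<and> le (X i) (Z i)"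
    "monotone_on I r le Y" "is_supremum P le (Y ` I) x"
    "monotone_on I r (\<lambda>a b. le b a) Z" "is_infimum P le (Z ` I) x"
    using x unfolding order_convergent_def by blast
  define f where "f = (\<lambda>i. (Y i, X i, Z i))"
  define s where "s = (\<lambda>(p :: 'a \<times> 'a \<times> 'a) (q :: 'a \<times> 'a \<times> 'a). le (fst p) (fst q) \<and> le (snd (snd q)) (snd (snd p)))"
  have rf: "reflp_on P le" and tr: "transp_on P le" using po by (auto simp: poset_def)
  have YP: "Y i \<in> P" "Z i \<in> P" if "i \<in> I" for i using YZ that by auto
  have dir: "directed_set (f ` I) s"
    unfolding directed_set_def
  proof (intro conjI)
    show "f ` I \<noteq> {}" using I by (simp add: directed_set_def)
    show "reflp_on (f ` I) s"
      using reflp_onD[OF rf] YP by (auto intro!: reflp_onI simp: s_def f_def)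
    show "transp_on (f ` I) s"
    proof (rule transp_onI)
      fix p q t assume *: "p \<in> f ` I" "q \<in> f ` I" "t \<in> f ` I" and pqt: "s p q" "s q t"
      have "fst v \<in> P \<and> snd (snd v) \<in> P" if "v \<in> f ` I" for v
        using that YP by (auto simp: f_def)
      then have "le (fst p) (fst t)" "le (snd (snd t)) (snd (snd p))"
        using * pqt transp_onD[OF tr, of "fst p" "fst q" "fst t"]
          transp_onD[OF tr, of "snd (snd t)" "snd (snd q)" "snd (snd p)"] by (auto simp: s_def)
      then show "s p t" by (simp add: s_def)
    qed
    show "\<forall>p\<in>f ` I. \<forall>q\<in>f ` I. \<exists>t\<in>f ` I. s p t \<and> s q t"
    proof (intro ballI)
      fix p q assume "p \<in> f ` I" "q \<in> f ` I"
      then obtain i j where ij: "i \<in> I" "j \<in> I" and pq: "p = f i" "q = f j" by blast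
      then obtain k where k: "k \<in> I" "r i k" "r j k" using I by (auto simp: directed_set_def)
      then have "s (f i) (f k) \<and> s (f j) (f k)"
        using ij monotone_onD[OF YZ(4)] monotone_onD[OF YZ(6)] by (auto simp: s_def f_def)
      then show "\<exists>t\<in>f ` I. s p t \<and> s q t" using k(1) pq by blast
    qed
  qed
  have im: "fst ` (f ` I) = Y ` I" "(\<lambda>p. snd (snd p)) ` (f ` I) = Z ` I"
    by (auto simp: f_def image_image)
  have "order_convergent P le (f ` I) s (\<lambda>p. fst (snd p)) x"
    unfolding order_convergent_def
  proof (intro exI conjI)
    show "fst ` (f ` I) \<subseteq> P" "(\<lambda>p. snd (snd p)) ` (f ` I) \<subseteq> P"
      unfolding im using YZ by auto
    show "is_supremum P le (fst ` (f ` I)) x" "is_infimum P le ((\<lambda>p. snd (snd p)) ` (f ` I)) x"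
      unfolding im using YZ by auto
    show "\<forall>p\<in>f ` I. le (fst p) (fst (snd p)) \<and> le (fst (snd p)) (snd (snd p))"
      using YZ(3) by (auto simp: f_def)
  qed (auto simp: monotone_on_def s_def)
  moreover have "(\<lambda>p. fst (snd p)) ` (f ` I) \<subseteq> C" using X by (auto simp: f_def)
  moreover have "x \<in> P - C" using YZ(5) xC by (auto simp: is_supremum_def)
  ultimately show False using C dir unfolding order_closed_def by blast
qed

lemma order_convergent_cofinal:
  assumes po: "poset P le" and J: "J \<subseteq> I" and cof: "\<forall>i\<in>I. \<exists>j\<in>J. r i j"
    and X: "order_convergent P le I r X x"
  shows "order_convergent P le J r X x"
proof -
  obtain Y Z where YZ: "Y ` I \<subseteq> P" "Z ` I \<subseteq> P" "\<forall>i\<in>I. le (Y i) (X i) \<and> le (X i) (Z i)"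
    "monotone_on I r le Y" "is_supremum P le (Y ` I) x"
    "monotone_on I r (\<lambda>a b. le b a) Z" "is_infimum P le (Z ` I) x"
    using X unfolding order_convergent_def by blast
  have tr: "transp_on P le" using po by (auto simp: poset_def)
  have up: "le (Y i) u" if u: "u \<in> P" "\<forall>s\<in>Y ` J. le s u" and i: "i \<in> I" for u i
  proof -
    obtain j where j: "j \<in> J" "r i j" using cof i by blast
    have "le (Y i) (Y j)" using monotone_onD[OF YZ(4)] j J i by blast
    moreover have "le (Y j) u" using u j by blast
    ultimately show ?thesis using transp_onD[OF tr, of "Y i" "Y j" u] YZ(1) u i j J by blast
  qed
  have down: "le u (Z i)" if u: "u \<in> P" "\<forall>s\<in>Z ` J. le u s" and i: "i \<in> I" for u i
  proof -
    obtain j where j: "j \<in> J" "r i j" using cof i by blast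
    have "le (Z j) (Z i)" using monotone_onD[OF YZ(6)] j J i by blast
    moreover have "le u (Z j)" using u j by blast
    ultimately show ?thesis using transp_onD[OF tr, of u "Z j" "Z i"] YZ(2) u i j J by blast
  qed
  have "is_supremum P le (Y ` J) x"
    using YZ(5) up J unfolding is_supremum_def by blast
  moreover have "is_infimum P le (Z ` J) x"
    using YZ(7) down J unfolding is_infimum_def by blast
  moreover have "monotone_on J r le Y" "monotone_on J r (\<lambda>a b. le b a) Z"
    using YZ(4,6) J by (auto intro: monotone_on_subset)
  ultimately show ?thesis
    unfolding order_convergent_def using YZ(1-3) J by blast
qed

lemma order_closed_Un:
  assumes po: "poset P le" and C: "order_closed P le C" and D: "order_closed P le D"
  shows "order_closed P le (C \<union> D)"
proof -
  have False if I: "directed_set I r" and X: "X ` I \<subseteq> C \<union> D" and x: "x \<in> P - (C \<union> D)"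
    and c: "order_convergent P le I r X x" for I :: "('a \<times> 'a \<times> 'a) set" and r X x
  proof -
    have tr: "transp_on I r" and rf: "reflp_on I r"
      and d: "\<And>i j. i \<in> I \<Longrightarrow> j \<in> I \<Longrightarrow> \<exists>k\<in>I. r i k \<and> r j k" and ne: "I \<noteq> {}"
      using I by (auto simp: directed_set_def)
    have no: False if E: "order_closed P le E" "x \<notin> E"
      and cof: "\<forall>i\<in>I. \<exists>j\<in>{j\<in>I. X j \<in> E}. r i j" for E
    proof -
      let ?J = "{j\<in>I. X j \<in> E}"
      have "directed_set ?J r"
        unfolding directed_set_def
      proof (intro conjI ballI)
        show "?J \<noteq> {}" using ne cof by blast
        show "reflp_on ?J r" using rf by (auto simp: reflp_on_def)
        show "transp_on ?J r" using tr by (rule transp_on_subset) auto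
        fix i j assume ij: "i \<in> ?J" "j \<in> ?J"
        then obtain k where k: "k \<in> I" "r i k" "r j k" using d by blast
        obtain l where l: "l \<in> ?J" "r k l" using cof k by blast
        show "\<exists>k\<in>?J. r i k \<and> r j k"
          using transp_onD[OF tr, of i k l] transp_onD[OF tr, of j k l] ij k l by blast
      qed
      moreover have "order_convergent P le ?J r X x"
        by (rule order_convergent_cofinal[OF po _ cof c]) auto
      moreover have "X ` ?J \<subseteq> E" by auto
      ultimately show False using order_closed_any_net[OF po E(1)] E(2) by blast
    qed
    obtain i where i: "i \<in> I" "\<And>j. j \<in> I \<Longrightarrow> r i j \<Longrightarrow> X j \<notin> C"
      using no[OF C] x by blast
    have "\<forall>k\<in>I. \<exists>j\<in>{j\<in>I. X j \<in> D}. r k j"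
    proof
      fix k assume k: "k \<in> I"
      then obtain l where l: "l \<in> I" "r i l" "r k l" using d i(1) by blast
      then have "X l \<in> D" using i(2) X by blast
      then show "\<exists>j\<in>{j\<in>I. X j \<in> D}. r k j" using l by blast
    qed
    then show False using no[OF D] x by blast
  qed
  then show ?thesis using C D unfolding order_closed_def by blast
qed

lemma closedin_order_topology:
  assumes po: "poset P le"
  shows "closedin (order_topology P le) C \<longleftrightarrow> order_closed P le C"
proof -
  let ?op = "\<lambda>U. U \<subseteq> P \<and> order_closed P le (P - U)"
  have "istopology ?op"
    unfolding istopology_def
  proof (intro conjI allI impI)
    fix U V assume "?op U" "?op V"
    moreover have "P - U \<inter> V = (P - U) \<union> (P - V)" by auto
    ultimately show "U \<inter> V \<subseteq> P" "order_closed P le (P - U \<inter> V)"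
      using order_closed_Un[OF po] by auto
  next
    fix K assume K: "\<forall>U\<in>K. ?op U"
    then show "\<Union>K \<subseteq> P" by auto
    show "order_closed P le (P - \<Union>K)"
      unfolding order_closed_def
    proof (intro conjI notI)
      assume "\<exists>(I :: ('a \<times> 'a \<times> 'a) set) r X x. directed_set I r \<and> X ` I \<subseteq> P - \<Union>K \<and>
                x \<in> P - (P - \<Union>K) \<and> order_convergent P le I r X x"
      then obtain I :: "('a \<times> 'a \<times> 'a) set" and r X x U where
        *: "directed_set I r" "X ` I \<subseteq> P - \<Union>K" "U \<in> K" "x \<in> U" "order_convergent P le I r X x"
        by blast
      then have "X ` I \<subseteq> P - U" by blast
      moreover have "order_closed P le (P - U)" using K *(3) by blast
      ultimately have "x \<in> P - U"
        using order_closed_any_net[OF po] *(1,5) by blast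
      then show False using *(4) by blast
    qed auto
  qed
  then have op: "openin (order_topology P le) = ?op"
    unfolding order_topology_def by (rule topology_inverse')
  have "order_closed P le {}" by (auto simp: order_closed_def directed_set_def)
  then have "topspace (order_topology P le) = P"
    unfolding topspace_def op by auto
  moreover have "order_closed P le C \<Longrightarrow> C \<subseteq> P" by (simp add: order_closed_def)
  moreover have "C \<subseteq> P \<Longrightarrow> P - (P - C) = C" by blast
  ultimately show ?thesis unfolding closedin_def op by auto
qed


section \<open>Bounded operators on a complex Hilbert space\<close>

class scaleC =
  fixes scaleC :: "complex \<Rightarrow> 'a \<Rightarrow> 'a"  (infixr \<open>*\<^sub>C\<close> 75)

text \<open>The inner product is linear in the second argument.\<close>

class complex_inner = real_normed_vector + scaleC +
  fixes cinner :: "'a \<Rightarrow> 'a \<Rightarrow> complex"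
  assumes scaleC_of_real: "complex_of_real t *\<^sub>C x = t *\<^sub>R x"
    and scaleC_add_right: "c *\<^sub>C (x + y) = c *\<^sub>C x + c *\<^sub>C y"
    and scaleC_add_left: "(c + d) *\<^sub>C x = c *\<^sub>C x + d *\<^sub>C x"
    and scaleC_scaleC: "c *\<^sub>C d *\<^sub>C x = (c * d) *\<^sub>C x"
    and cinner_commute: "cinner x y = cnj (cinner y x)"
    and cinner_add_right: "cinner x (y + z) = cinner x y + cinner x z"
    and cinner_scaleC_right: "cinner x (c *\<^sub>C y) = c * cinner x y"
    and cinner_self: "cinner x x = complex_of_real ((norm x)\<^sup>2)"

class chilbert_space = complex_inner + banach

lemma cinner_scaleC_left: "cinner (c *\<^sub>C x) y = cnj c * cinner x y"
  by (metis cinner_commute cinner_scaleC_right complex_cnj_mult)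

lemma norm_scaleC: "norm (c *\<^sub>C x) = cmod c * norm (x :: 'a::complex_inner)"
proof -
  have "complex_of_real ((norm (c *\<^sub>C x))\<^sup>2) = (c * cnj c) * complex_of_real ((norm x)\<^sup>2)"
    by (simp only: cinner_self [symmetric] cinner_scaleC_right cinner_scaleC_left mult.assoc)
  also have "\<dots> = complex_of_real ((cmod c * norm x)\<^sup>2)"
    by (simp only: complex_norm_square[symmetric] power_mult_distrib of_real_mult)
  finally have "(norm (c *\<^sub>C x))\<^sup>2 = (cmod c * norm x)\<^sup>2"
    using of_real_eq_iff by blast
  then show ?thesis by (simp add: power2_eq_iff_nonneg)
qed

text \<open>The library type of bounded operators consists of the bounded \<^emph>\<open>real\<close>-linear maps;
  \<open>bounded_ops\<close> singles out the complex-linear ones. Composition is \<open>o\<^sub>L\<close> and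
  the library norm is the operator norm.\<close>

definition bounded_ops :: "('h::complex_inner \<Rightarrow>\<^sub>L 'h) set" where
  "bounded_ops = {T :: 'h \<Rightarrow>\<^sub>L 'h. \<forall>c x. T (c *\<^sub>C x) = c *\<^sub>C T x}"

instantiation blinfun :: (complex_inner, complex_inner) scaleC
begin

lift_definition scaleC_blinfun :: "complex \<Rightarrow> ('a \<Rightarrow>\<^sub>L 'b) \<Rightarrow> ('a \<Rightarrow>\<^sub>L 'b)"
  is "\<lambda>c T x. c *\<^sub>C T x"
proof -
  fix c :: complex and T :: "'a \<Rightarrow> 'b"
  assume "bounded_linear T"
  moreover have "bounded_linear (\<lambda>y::'b. c *\<^sub>C y)"
  proof (rule bounded_linear_intro[where K = "cmod c"])
    show "c *\<^sub>C (t *\<^sub>R y) = t *\<^sub>R (c *\<^sub>C y)" for t and y :: 'b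
      by (metis mult.commute scaleC_of_real scaleC_scaleC)
  qed (auto simp: scaleC_add_right norm_scaleC mult.commute)
  ultimately show "bounded_linear (\<lambda>x. c *\<^sub>C T x)"
    using bounded_linear_compose by blast
qed

instance ..

end

definition cadjoint :: "('h::complex_inner \<Rightarrow>\<^sub>L 'h) \<Rightarrow> ('h \<Rightarrow>\<^sub>L 'h)"  (\<open>_\<^sup>\<dagger>\<close> [1000] 999) where
  "T\<^sup>\<dagger> = (THE S :: 'h \<Rightarrow>\<^sub>L 'h. \<forall>\<xi> \<eta>. cinner (T \<xi>) \<eta> = cinner \<xi> (S \<eta>))"


section \<open>Von Neumann algebras, normal functionals, the star order and the \<open>\<sigma>\<close>-strong* topology\<close>

definition cstar_subalgebra :: "('h::chilbert_space \<Rightarrow>\<^sub>L 'h) set \<Rightarrow> bool" where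
  "cstar_subalgebra M \<longleftrightarrow> M \<subseteq> bounded_ops \<and> 0 \<in> M \<and>
     (\<forall>x\<in>M. \<forall>y\<in>M. x + y \<in> M) \<and> (\<forall>c. \<forall>x\<in>M. c *\<^sub>C x \<in> M) \<and>
     (\<forall>x\<in>M. \<forall>y\<in>M. x o\<^sub>L y \<in> M) \<and> (\<forall>x\<in>M. x\<^sup>\<dagger> \<in> M) \<and> closed M"

text \<open>\<open>M\<close> is not required to contain the identity operator of the Hilbert space.\<close>

definition von_neumann_algebra :: "('h::chilbert_space \<Rightarrow>\<^sub>L 'h) set \<Rightarrow> bool" where
  "von_neumann_algebra M \<longleftrightarrow> cstar_subalgebra M \<and>
     closedin (subtopology strong_operator_topology bounded_ops) M"

definition selfadjoint_part :: "('h::chilbert_space \<Rightarrow>\<^sub>L 'h) set \<Rightarrow> ('h \<Rightarrow>\<^sub>L 'h) set" where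
  "selfadjoint_part M = {x\<in>M. x\<^sup>\<dagger> = x}"

definition op_le :: "('h::chilbert_space \<Rightarrow>\<^sub>L 'h) \<Rightarrow> ('h \<Rightarrow>\<^sub>L 'h) \<Rightarrow> bool" where
  "op_le a b \<longleftrightarrow> (\<forall>\<xi>. cinner \<xi> ((b - a) \<xi>) \<in> \<real>\<^sub>\<ge>\<^sub>0)"

text \<open>Functionals on \<open>M\<close> are total functions of which only the values on \<open>M\<close> matter.\<close>

definition bounded_functional ::
  "('h::chilbert_space \<Rightarrow>\<^sub>L 'h) set \<Rightarrow> (('h \<Rightarrow>\<^sub>L 'h) \<Rightarrow> complex) \<Rightarrow> bool" where
  "bounded_functional M \<phi> \<longleftrightarrow>
     (\<forall>x\<in>M. \<forall>y\<in>M. \<phi> (x + y) = \<phi> x + \<phi> y) \<and> (\<forall>c. \<forall>x\<in>M. \<phi> (c *\<^sub>C x) = c * \<phi> x) \<and>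
     (\<exists>K. \<forall>x\<in>M. cmod (\<phi> x) \<le> K * norm x)"

definition positive_functional ::
  "('h::chilbert_space \<Rightarrow>\<^sub>L 'h) set \<Rightarrow> (('h \<Rightarrow>\<^sub>L 'h) \<Rightarrow> complex) \<Rightarrow> bool" where
  "positive_functional M \<phi> \<longleftrightarrow> (\<forall>x\<in>M. \<phi> (x\<^sup>\<dagger> o\<^sub>L x) \<in> \<real>\<^sub>\<ge>\<^sub>0)"

text \<open>Normality: \<open>\<phi> (a\<^sub>i)\<close> tends to \<open>\<phi> a\<close> whenever \<open>(a\<^sub>i)\<close> is an increasing net of self-adjoint
  elements with supremum \<open>a\<close>. Such a net may be replaced by its range, an upward directed set
  regarded as a net indexed by itself.\<close>

definition normal_functional ::
  "('h::chilbert_space \<Rightarrow>\<^sub>L 'h) set \<Rightarrow> (('h \<Rightarrow>\<^sub>L 'h) \<Rightarrow> complex) \<Rightarrow> bool" where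
  "normal_functional M \<phi> \<longleftrightarrow>
     (\<forall>D a. D \<subseteq> selfadjoint_part M \<and> directed_set D op_le \<and>
        is_supremum (selfadjoint_part M) op_le D a \<longrightarrow> (\<phi> \<longlongrightarrow> \<phi> a) (net_filter D op_le))"

definition predual :: "('h::chilbert_space \<Rightarrow>\<^sub>L 'h) set \<Rightarrow> (('h \<Rightarrow>\<^sub>L 'h) \<Rightarrow> complex) set" where
  "predual M = {\<phi>. bounded_functional M \<phi> \<and> normal_functional M \<phi>}"

definition sigma_strong_star_seminorm ::
  "(('h::chilbert_space \<Rightarrow>\<^sub>L 'h) \<Rightarrow> complex) \<Rightarrow> ('h \<Rightarrow>\<^sub>L 'h) \<Rightarrow> real" where
  "sigma_strong_star_seminorm \<phi> x = sqrt (Re (\<phi> (x\<^sup>\<dagger> o\<^sub>L x) + \<phi> (x o\<^sub>L x\<^sup>\<dagger>)))"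

definition sigma_strong_star_topology ::
  "('h::chilbert_space \<Rightarrow>\<^sub>L 'h) set \<Rightarrow> ('h \<Rightarrow>\<^sub>L 'h) topology" where
  "sigma_strong_star_topology M = topology_generated_by
     {{y\<in>M. sigma_strong_star_seminorm \<phi> (y - x) < \<epsilon>} | \<phi> x \<epsilon>.
        \<phi> \<in> predual M \<and> positive_functional M \<phi> \<and> x \<in> M \<and> \<epsilon> > 0}"

definition star_le :: "('h::chilbert_space \<Rightarrow>\<^sub>L 'h) \<Rightarrow> ('h \<Rightarrow>\<^sub>L 'h) \<Rightarrow> bool"  (infix \<open>\<preceq>\<^sub>\<star>\<close> 50) where
  "x \<preceq>\<^sub>\<star> y \<longleftrightarrow> x\<^sup>\<dagger> o\<^sub>L x = x\<^sup>\<dagger> o\<^sub>L y \<and> x o\<^sub>L x\<^sup>\<dagger> = y o\<^sub>L x\<^sup>\<dagger>"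

end

theory Submission
  imports Defs
begin

text \<open>Half of the star order, \<open>a\<^sup>* a = a\<^sup>* b\<close>, says that \<open>b = a + (b - a)\<close> is a decomposition with
  orthogonal ranges; the other half says the same about the adjoints. Pythagoras then turns
  differences into squares: \<open>(b - a)\<^sup>* (b - a) = b\<^sup>* b - a\<^sup>* a\<close> (\<open>left_star_le_diff_square\<close>). Convergence
  is proved for one half of the order and applied to operators and to their adjoints.

  Let \<open>y\<^sub>i \<preceq> x\<^sub>i \<preceq> z\<^sub>i\<close> with \<open>y\<^sub>i\<close> increasing to \<open>x\<close> and \<open>z\<^sub>i\<close> decreasing to \<open>x\<close> in the star order. By
  Pythagoras \<open>\<parallel>y\<^sub>j \<xi> - y\<^sub>i \<xi>\<parallel>\<^sup>2 = \<parallel>y\<^sub>j \<xi>\<parallel>\<^sup>2 - \<parallel>y\<^sub>i \<xi>\<parallel>\<^sup>2\<close>, a difference of values of a bounded monotone function,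
  so \<open>y\<^sub>i\<close> converges strongly. The limit lies in the algebra, and since orthogonality passes to strong
  limits it is the least upper bound, hence equals \<open>x\<close> (\<open>star_supremum_strong_limit\<close>, and
  \<open>star_infimum_strong_limit\<close> for \<open>z\<^sub>i\<close>).

  Consequently \<open>y\<^sub>i\<^sup>* y\<^sub>i\<close> is an increasing net of self-adjoint elements with supremum \<open>x\<^sup>* x\<close>, and
  \<open>- z\<^sub>i\<^sup>* z\<^sub>i\<close> one with supremum \<open>- x\<^sup>* x\<close>. For a normal positive \<open>\<phi>\<close>, with \<open>q a = \<phi> (a\<^sup>* a)\<close>, both
  \<open>q y\<^sub>i\<close> and \<open>q z\<^sub>i\<close> therefore tend to \<open>q x\<close>, and
  \<open>q (x\<^sub>i - x) \<le> 2 q (x\<^sub>i - y\<^sub>i) + 2 q (x - y\<^sub>i) \<le> 2 (q z\<^sub>i - q y\<^sub>i) + 2 (q x - q y\<^sub>i)\<close>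
  tends to \<open>0\<close> (\<open>gns_square_squeeze\<close>). Every inequality between values of \<open>q\<close> here
  comes from \<open>q a \<ge> 0\<close>, applied to a difference of comparable elements or to \<open>t a - b\<close>.

  The inclusion of topologies follows: a net in the complement of a \<open>\<sigma>\<close>-strong* open set cannot be
  order convergent to a point of that set.\<close>

section \<open>Complex inner products\<close>

lemma cinner_add_left: "cinner (x + y) z = cinner x z + cinner y (z :: 'a::complex_inner)"
  by (metis cinner_add_right cinner_commute complex_cnj_add)

lemma cinner_scaleR_right: "cinner x (t *\<^sub>R y) = complex_of_real t * cinner x (y :: 'a::complex_inner)"
  by (metis cinner_scaleC_right scaleC_of_real)

lemma cinner_scaleR_left: "cinner (t *\<^sub>R x) y = complex_of_real t * cinner x (y :: 'a::complex_inner)"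
  by (metis cinner_scaleC_left complex_cnj_complex_of_real scaleC_of_real)

lemma cinner_minus_right: "cinner x (- y) = - cinner x (y :: 'a::complex_inner)"
  using cinner_scaleR_right[of x "-1" y] by simp

lemma cinner_minus_left: "cinner (- x) y = - cinner x (y :: 'a::complex_inner)"
  using cinner_scaleR_left[of "-1" x y] by simp

lemma cinner_diff_right: "cinner x (y - z) = cinner x y - cinner x (z :: 'a::complex_inner)"
  using cinner_add_right[of x y "- z"] by (simp add: cinner_minus_right)

lemma cinner_diff_left: "cinner (x - y) z = cinner x z - cinner y (z :: 'a::complex_inner)"
  using cinner_add_left[of x "- y" z] by (simp add: cinner_minus_left)

lemma cinner_zero_right [simp]: "cinner x (0 :: 'a::complex_inner) = 0"
  using cinner_diff_right[of x 0 0] by simp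

lemmas cinner_algebra = cinner_add_left cinner_add_right cinner_diff_left cinner_diff_right
  cinner_minus_left cinner_minus_right cinner_scaleR_left cinner_scaleR_right

lemma bounded_linear_scaleC_right: "bounded_linear (\<lambda>x. c *\<^sub>C (x :: 'a::complex_inner))"
proof (rule bounded_linear_intro[where K = "cmod c"])
  show "c *\<^sub>C (t *\<^sub>R x) = t *\<^sub>R (c *\<^sub>C x)" for t and x :: 'a
    by (metis mult.commute scaleC_of_real scaleC_scaleC)
qed (auto simp: scaleC_add_right norm_scaleC mult.commute)

lemma Re_cinner_commute: "Re (cinner x y) = Re (cinner y (x :: 'a::complex_inner))"
  by (metis cinner_commute cnj.sel(1))

lemma power2_norm_eq_Re_cinner: "(norm x)\<^sup>2 = Re (cinner x (x :: 'a::complex_inner))"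
  by (simp add: cinner_self)

lemma cinner_self_eq_0_iff [simp]: "cinner x x = 0 \<longleftrightarrow> x = (0 :: 'a::complex_inner)"
  by (simp add: cinner_self)

lemma cinner_eq_iff_right: "(\<forall>x. cinner x y = cinner x z) \<longleftrightarrow> y = (z :: 'a::complex_inner)"
proof
  assume "\<forall>x. cinner x y = cinner x z"
  then have "cinner (y - z) (y - z) = 0" by (simp add: cinner_diff_right)
  then show "y = z" by simp
qed simp

lemma power2_norm_add_scaleR:
  "(norm (v + t *\<^sub>R w))\<^sup>2 = (norm v)\<^sup>2 + 2 * t * Re (cinner v w) + t\<^sup>2 * (norm (w :: 'a::complex_inner))\<^sup>2"
  unfolding power2_norm_eq_Re_cinner using Re_cinner_commute[of v w]
  by (simp add: cinner_algebra algebra_simps power2_eq_square)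

text \<open>Subtracting from \<open>x\<close> its component along \<open>y\<close> leaves a vector of non-negative squared norm; the
  vector \<open>w\<close> is this difference times \<open>\<parallel>y\<parallel>\<^sup>2\<close>, which avoids division.\<close>

lemma cinner_Cauchy_Schwarz: "cmod (cinner x y) \<le> norm x * norm (y :: 'a::complex_inner)"
proof (cases "y = 0")
  case False
  define c where "c = cinner y x"
  define n where "n = complex_of_real ((norm y)\<^sup>2)"
  have yx: "cinner x y = cnj c" unfolding c_def by (rule cinner_commute)
  have nn: "cnj n = n" by (simp add: n_def)
  define w where "w = n *\<^sub>C x - c *\<^sub>C y"
  have "cinner w w = n * (n * cinner x x) - n * (c * cinner x y) - cnj c * (n * cinner y x)
      + cnj c * (c * cinner y y)"
    by (simp add: w_def cinner_diff_left cinner_diff_right cinner_scaleC_left cinner_scaleC_right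
        nn algebra_simps)
  also have "\<dots> = n * (n * complex_of_real ((norm x)\<^sup>2) - c * cnj c)"
    unfolding cinner_self n_def[symmetric] yx c_def[symmetric] by (simp add: algebra_simps)
  also have "c * cnj c = complex_of_real ((cmod c)\<^sup>2)"
    by (rule complex_norm_square[symmetric])
  finally have "complex_of_real ((norm w)\<^sup>2)
      = complex_of_real ((norm y)\<^sup>2 * ((norm y)\<^sup>2 * (norm x)\<^sup>2 - (cmod c)\<^sup>2))"
    by (simp add: cinner_self n_def)
  then have "0 \<le> (norm y)\<^sup>2 * ((norm y)\<^sup>2 * (norm x)\<^sup>2 - (cmod c)\<^sup>2)"
    by (metis of_real_eq_iff zero_le_power2)
  then have "(cmod c)\<^sup>2 \<le> (norm x * norm y)\<^sup>2"
    using False by (simp add: zero_le_mult_iff power_mult_distrib mult.commute)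
  then have "cmod c \<le> norm x * norm y" by (rule power2_le_imp_le) simp
  then show ?thesis by (simp add: yx)
qed simp

lemma bounded_bilinear_cinner: "bounded_bilinear (cinner :: 'a::complex_inner \<Rightarrow> 'a \<Rightarrow> complex)"
  by (unfold_locales, auto simp: cinner_algebra scaleR_conv_of_real intro!: exI[of _ 1] cinner_Cauchy_Schwarz)

lemmas tendsto_cinner = bounded_bilinear.tendsto[OF bounded_bilinear_cinner]

section \<open>Adjoints of bounded operators\<close>

text \<open>The representing vector is the minimiser of \<open>J v = \<parallel>v\<parallel>\<^sup>2 - 2 f v\<close>: by the parallelogram law,
  minimising sequences of \<open>J\<close> are Cauchy, and the first variation of \<open>J\<close> at \<open>v\<close> in the direction
  \<open>w\<close> is \<open>2 (Re (cinner v w) - f w)\<close>.\<close>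

lemma Riesz_representation_Re:
  fixes f :: "'a::chilbert_space \<Rightarrow> real"
  assumes f: "bounded_linear f"
  obtains v where "\<And>w. f w = Re (cinner v w)"
proof -
  interpret bounded_linear f by (rule f)
  define J where "J = (\<lambda>v. (norm v)\<^sup>2 - 2 * f v)"
  obtain K where K: "\<And>v. norm (f v) \<le> norm v * K" using bounded by blast
  have J_below: "- K\<^sup>2 \<le> J v" for v
  proof -
    have "0 \<le> (norm v - K)\<^sup>2" by simp
    moreover have "f v \<le> norm v * K" using K[of v] by simp
    ultimately show ?thesis by (simp add: J_def power2_diff)
  qed
  define d where "d = Inf (range J)"
  have bdd: "bdd_below (range J)" using J_below by (auto intro!: bdd_belowI[of _ "- K\<^sup>2"])
  have dJ: "d \<le> J v" for v unfolding d_def using bdd by (auto intro: cInf_lower)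
  have close: "(norm (u - v))\<^sup>2 \<le> 2 * (J u + J v - 2 * d)" for u v
  proof -
    have "J u + J v = 2 * J ((1/2) *\<^sub>R (u + v)) + (norm (u - v))\<^sup>2 / 2"
      using Re_cinner_commute[of u v] unfolding J_def scaleR add
      by (simp add: power2_norm_eq_Re_cinner cinner_algebra field_simps)
    then show ?thesis using dJ[of "(1/2) *\<^sub>R (u + v)"] by simp
  qed
  have "\<exists>v. J v < d + inverse (real (Suc n))" for n
    using cInf_less_iff[of "range J" "d + inverse (real (Suc n))"] bdd
    by (auto simp: d_def[symmetric])
  then obtain s where s: "\<And>n. J (s n) < d + inverse (real (Suc n))" by metis
  have "Cauchy s"
  proof (rule CauchyI)
    fix e :: real assume e: "0 < e"
    then obtain N where N: "inverse (real (Suc N)) < e\<^sup>2 / 4"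
      using reals_Archimedean[of "e\<^sup>2 / 4"] by auto
    have "norm (s m - s n) < e" if "N \<le> m" "N \<le> n" for m n
    proof -
      have "J (s k) - d < e\<^sup>2 / 4" if "N \<le> k" for k
      proof -
        have "inverse (real (Suc k)) \<le> inverse (real (Suc N))"
          using that by (intro le_imp_inverse_le) auto
        then show ?thesis using s[of k] N by linarith
      qed
      from this[OF \<open>N \<le> m\<close>] this[OF \<open>N \<le> n\<close>] have "(norm (s m - s n))\<^sup>2 < e\<^sup>2"
        using close[of "s m" "s n"] by simp
      then show ?thesis using e by (simp add: power2_less_imp_less)
    qed
    then show "\<exists>N. \<forall>m\<ge>N. \<forall>n\<ge>N. norm (s m - s n) < e" by blast
  qed
  then obtain v where v: "s \<longlonglongrightarrow> v" using Cauchy_convergent_iff convergent_def by blast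
  have "(\<lambda>n. J (s n)) \<longlonglongrightarrow> J v"
    unfolding J_def by (intro tendsto_intros v tendsto)
  moreover have "(\<lambda>n. d + inverse (real (Suc n))) \<longlonglongrightarrow> d + 0"
    by (intro tendsto_intros LIMSEQ_inverse_real_of_nat)
  ultimately have "J v \<le> d + 0"
    by (rule LIMSEQ_le) (use s less_imp_le in blast)
  then have min: "J v \<le> J u" for u using dJ[of u] by simp
  have "f w = Re (cinner v w)" for w
  proof -
    define c where "c = Re (cinner v w) - f w"
    define n where "n = (norm w)\<^sup>2"
    have n0: "0 \<le> n" by (simp add: n_def)
    have quad: "0 \<le> t\<^sup>2 * n + 2 * t * c" for t
      using min[of "v + t *\<^sub>R w"] unfolding J_def power2_norm_add_scaleR add scaleR
      by (simp add: c_def n_def algebra_simps)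
    \<comment> \<open>Moving against the gradient \<open>2 c\<close> by a step short enough to beat the quadratic term; the
        \<open>1\<close> keeps the denominator positive.\<close>
    define t where "t = - c / (n + 1)"
    have c: "c = - t * (n + 1)" using n0 by (simp add: t_def)
    have "t\<^sup>2 * (n + 2) \<le> 0"
      using quad[of t] by (simp add: c algebra_simps power2_eq_square)
    then have "c = 0" using n0 by (auto simp: c mult_le_0_iff)
    then show ?thesis by (simp add: c_def)
  qed
  then show thesis by (rule that)
qed

lemma bounded_ops_scaleC: "T \<in> bounded_ops \<Longrightarrow> T (c *\<^sub>C \<xi>) = c *\<^sub>C T \<xi>"
  by (simp add: bounded_ops_def)

text \<open>The vector that represents \<open>\<xi> \<mapsto> Re (cinner \<eta> (T \<xi>))\<close> is the value of the adjoint at \<open>\<eta>\<close>;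
  complex linearity of \<open>T\<close> recovers the imaginary part from the real part at \<open>\<i> \<xi>\<close>.\<close>

lemma adjoint_exists:
  fixes T :: "'h::chilbert_space \<Rightarrow>\<^sub>L 'h"
  assumes T: "T \<in> bounded_ops"
  shows "\<exists>S :: 'h \<Rightarrow>\<^sub>L 'h. \<forall>\<xi> \<eta>. cinner (T \<xi>) \<eta> = cinner \<xi> (S \<eta>)"
proof -
  have "\<exists>v. \<forall>\<xi>. Re (cinner \<eta> (T \<xi>)) = Re (cinner v \<xi>)" for \<eta>
  proof -
    have "bounded_linear (\<lambda>\<xi>. Re (cinner \<eta> (T \<xi>)))"
      by (intro bounded_linear_compose[OF bounded_linear_Re]
          bounded_linear_compose[OF bounded_bilinear.bounded_linear_right[OF bounded_bilinear_cinner]]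
          blinfun.bounded_linear_right)
    then show ?thesis by (metis Riesz_representation_Re)
  qed
  then obtain S where re: "\<And>\<eta> \<xi>. Re (cinner \<eta> (T \<xi>)) = Re (cinner (S \<eta>) \<xi>)" by metis
  have im: "Im (cinner \<eta> (T \<xi>)) = Im (cinner (S \<eta>) \<xi>)" for \<eta> \<xi>
    using re[of \<eta> "\<i> *\<^sub>C \<xi>"] by (simp add: bounded_ops_scaleC[OF T] cinner_scaleC_right)
  have S: "cinner (T \<xi>) \<eta> = cinner \<xi> (S \<eta>)" for \<xi> \<eta>
    by (metis re im cinner_commute complex_eqI)
  have lin: "S (\<eta> + \<zeta>) = S \<eta> + S \<zeta>" "S (t *\<^sub>R \<eta>) = t *\<^sub>R S \<eta>" for \<eta> \<zeta> t
    by (subst cinner_eq_iff_right[symmetric], simp add: cinner_algebra S[symmetric])+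
  have bd: "norm (S \<eta>) \<le> norm \<eta> * norm T" for \<eta>
  proof (cases "S \<eta> = 0")
    case False
    have "(norm (S \<eta>))\<^sup>2 = Re (cinner (T (S \<eta>)) \<eta>)"
      by (simp add: power2_norm_eq_Re_cinner S)
    also have "\<dots> \<le> norm (T (S \<eta>)) * norm \<eta>"
      using cinner_Cauchy_Schwarz[of "T (S \<eta>)" \<eta>] complex_Re_le_cmod order_trans by blast
    also have "\<dots> \<le> (norm T * norm (S \<eta>)) * norm \<eta>"
      by (intro mult_right_mono norm_blinfun) simp
    finally have "norm (S \<eta>) * norm (S \<eta>) \<le> (norm \<eta> * norm T) * norm (S \<eta>)"
      by (simp add: power2_eq_square mult_ac)
    then show ?thesis using False by (simp add: mult_le_cancel_right)
  qed simp
  have "bounded_linear S" using lin bd by (rule bounded_linear_intro)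
  then show ?thesis using S bounded_linear_Blinfun_apply by metis
qed

lemma cadjoint_unique:
  fixes T S :: "'h::complex_inner \<Rightarrow>\<^sub>L 'h"
  assumes "\<And>\<xi> \<eta>. cinner (T \<xi>) \<eta> = cinner \<xi> (S \<eta>)"
  shows "T\<^sup>\<dagger> = S"
  unfolding cadjoint_def
proof (rule the_equality)
  show "\<forall>\<xi> \<eta>. cinner (T \<xi>) \<eta> = cinner \<xi> (S \<eta>)" using assms by blast
  fix R :: "'h \<Rightarrow>\<^sub>L 'h" assume "\<forall>\<xi> \<eta>. cinner (T \<xi>) \<eta> = cinner \<xi> (R \<eta>)"
  then have "R \<eta> = S \<eta>" for \<eta> using assms cinner_eq_iff_right by metis
  then show "R = S" by (rule blinfun_eqI)
qed

lemma cinner_cadjoint_right: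
  "T \<in> bounded_ops \<Longrightarrow> cinner \<xi> ((T\<^sup>\<dagger>) \<eta>) = cinner (T \<xi>) (\<eta> :: 'h::chilbert_space)"
  using adjoint_exists[of T] cadjoint_unique[of T] by metis

lemma cinner_cadjoint_left:
  "T \<in> bounded_ops \<Longrightarrow> cinner ((T\<^sup>\<dagger>) \<xi>) \<eta> = cinner \<xi> (T (\<eta> :: 'h::chilbert_space))"
  by (metis cinner_cadjoint_right cinner_commute)

lemma cadjoint_cadjoint: "T \<in> bounded_ops \<Longrightarrow> (T\<^sup>\<dagger>)\<^sup>\<dagger> = (T :: 'h::chilbert_space \<Rightarrow>\<^sub>L 'h)"
  by (rule cadjoint_unique) (rule cinner_cadjoint_left)

lemma cadjoint_diff:
  "S \<in> bounded_ops \<Longrightarrow> T \<in> bounded_ops \<Longrightarrow> (S - T)\<^sup>\<dagger> = S\<^sup>\<dagger> - (T :: 'h::chilbert_space \<Rightarrow>\<^sub>L 'h)\<^sup>\<dagger>"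
  by (rule cadjoint_unique) (simp add: blinfun.diff_left cinner_algebra cinner_cadjoint_right)

lemma cadjoint_add:
  "S \<in> bounded_ops \<Longrightarrow> T \<in> bounded_ops \<Longrightarrow> (S + T)\<^sup>\<dagger> = S\<^sup>\<dagger> + (T :: 'h::chilbert_space \<Rightarrow>\<^sub>L 'h)\<^sup>\<dagger>"
  by (rule cadjoint_unique) (simp add: blinfun.add_left cinner_algebra cinner_cadjoint_right)

lemma cadjoint_scaleR:
  "T \<in> bounded_ops \<Longrightarrow> (t *\<^sub>R T)\<^sup>\<dagger> = t *\<^sub>R (T :: 'h::chilbert_space \<Rightarrow>\<^sub>L 'h)\<^sup>\<dagger>"
  by (rule cadjoint_unique) (simp add: blinfun.scaleR_left cinner_algebra cinner_cadjoint_right)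

lemma cadjoint_comp:
  "S \<in> bounded_ops \<Longrightarrow> T \<in> bounded_ops \<Longrightarrow> (S o\<^sub>L T)\<^sup>\<dagger> = T\<^sup>\<dagger> o\<^sub>L (S :: 'h::chilbert_space \<Rightarrow>\<^sub>L 'h)\<^sup>\<dagger>"
  by (rule cadjoint_unique) (simp add: cinner_cadjoint_right)

lemma scaleC_of_real_blinfun:
  "complex_of_real t *\<^sub>C T = t *\<^sub>R (T :: 'h::complex_inner \<Rightarrow>\<^sub>L 'h)"
  by (rule blinfun_eqI) (simp add: scaleC_blinfun.rep_eq scaleC_of_real blinfun.scaleR_left)

lemma cadjoint_bounded_ops: "T \<in> bounded_ops \<Longrightarrow> T\<^sup>\<dagger> \<in> (bounded_ops :: ('h::chilbert_space \<Rightarrow>\<^sub>L 'h) set)"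
proof -
  assume T: "T \<in> bounded_ops"
  have "(T\<^sup>\<dagger>) (c *\<^sub>C \<eta>) = c *\<^sub>C (T\<^sup>\<dagger>) \<eta>" for c \<eta>
    by (subst cinner_eq_iff_right[symmetric]) (simp add: cinner_cadjoint_right[OF T] cinner_scaleC_right)
  then show ?thesis by (simp add: bounded_ops_def)
qed

lemma blinfun_eq_cinnerI:
  fixes S T :: "'h::complex_inner \<Rightarrow>\<^sub>L 'h"
  assumes "\<And>\<xi> \<eta>. cinner \<xi> (S \<eta>) = cinner \<xi> (T \<eta>)"
  shows "S = T"
  using assms by (intro blinfun_eqI) (simp add: cinner_eq_iff_right[symmetric])

section \<open>The star order\<close>

text \<open>One half of the star order. It says that the range of \<open>b - a\<close> is orthogonal to the range of
  \<open>a\<close>; the star order is this relation between the operators and between their adjoints.\<close>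

definition left_star_le :: "('h::chilbert_space \<Rightarrow>\<^sub>L 'h) \<Rightarrow> ('h \<Rightarrow>\<^sub>L 'h) \<Rightarrow> bool" where
  "left_star_le a b \<longleftrightarrow> a\<^sup>\<dagger> o\<^sub>L a = a\<^sup>\<dagger> o\<^sub>L b"

lemma left_star_le_iff_cinner:
  assumes "a \<in> bounded_ops"
  shows "left_star_le a b \<longleftrightarrow> (\<forall>\<xi> \<eta>. cinner (a \<xi>) (a \<eta>) = cinner (a \<xi>) (b \<eta>))"
proof -
  have "left_star_le a b \<longleftrightarrow> (\<forall>\<xi> \<eta>. cinner \<xi> ((a\<^sup>\<dagger> o\<^sub>L a) \<eta>) = cinner \<xi> ((a\<^sup>\<dagger> o\<^sub>L b) \<eta>))"
    unfolding left_star_le_def using blinfun_eq_cinnerI by metis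
  then show ?thesis by (simp only: blinfun_apply_blinfun_compose cinner_cadjoint_right[OF assms])
qed

text \<open>Taking adjoints turns \<open>a a\<^sup>* = b a\<^sup>*\<close> into \<open>a a\<^sup>* = a b\<^sup>*\<close>.\<close>

lemma star_le_iff_left_star_le:
  assumes a: "a \<in> bounded_ops" and b: "b \<in> bounded_ops"
  shows "a \<preceq>\<^sub>\<star> b \<longleftrightarrow> left_star_le a b \<and> left_star_le (a\<^sup>\<dagger>) (b\<^sup>\<dagger>)"
proof -
  have 1: "(a o\<^sub>L a\<^sup>\<dagger>)\<^sup>\<dagger> = a o\<^sub>L a\<^sup>\<dagger>" "(a o\<^sub>L b\<^sup>\<dagger>)\<^sup>\<dagger> = b o\<^sub>L a\<^sup>\<dagger>" "(b o\<^sub>L a\<^sup>\<dagger>)\<^sup>\<dagger> = a o\<^sub>L b\<^sup>\<dagger>"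
    by (simp_all add: cadjoint_comp cadjoint_bounded_ops cadjoint_cadjoint a b)
  have "a o\<^sub>L a\<^sup>\<dagger> = b o\<^sub>L a\<^sup>\<dagger> \<longleftrightarrow> a o\<^sub>L a\<^sup>\<dagger> = a o\<^sub>L b\<^sup>\<dagger>"
    using arg_cong[of "a o\<^sub>L a\<^sup>\<dagger>" _ cadjoint] 1 by auto
  then show ?thesis by (simp add: star_le_def left_star_le_def cadjoint_cadjoint a)
qed

lemma left_star_le_cinner:
  assumes "left_star_le a b" "a \<in> bounded_ops"
  shows "cinner (a \<xi>) (b \<eta>) = cinner (a \<xi>) (a \<eta>)" "cinner (b \<eta>) (a \<xi>) = cinner (a \<eta>) (a \<xi>)"
  using assms by (metis left_star_le_iff_cinner cinner_commute)+

text \<open>Pythagoras: \<open>b\<close> is the sum of \<open>a\<close> and \<open>b - a\<close>, whose ranges are orthogonal.\<close>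

lemma left_star_le_diff_square:
  assumes "left_star_le a b" "a \<in> bounded_ops" "b \<in> bounded_ops"
  shows "(b - a)\<^sup>\<dagger> o\<^sub>L (b - a) = (b\<^sup>\<dagger> o\<^sub>L b) - (a\<^sup>\<dagger> o\<^sub>L a)"
  by (intro blinfun_eq_cinnerI)
    (simp add: cadjoint_diff blinfun.diff_left blinfun.diff_right cinner_algebra
      cinner_cadjoint_right left_star_le_cinner assms)

lemma left_star_le_norm_diff:
  assumes "left_star_le a b" "a \<in> bounded_ops"
  shows "(norm (b \<xi> - a \<xi>))\<^sup>2 = (norm (b \<xi>))\<^sup>2 - (norm (a \<xi>))\<^sup>2"
  by (simp add: power2_norm_eq_Re_cinner cinner_algebra left_star_le_cinner[OF assms])

lemma left_star_le_norm_le: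
  assumes "left_star_le a b" "a \<in> bounded_ops"
  shows "norm (a \<xi>) \<le> norm (b \<xi>)"
proof (rule power2_le_imp_le)
  show "(norm (a \<xi>))\<^sup>2 \<le> (norm (b \<xi>))\<^sup>2"
    using left_star_le_norm_diff[OF assms, of \<xi>] zero_le_power2[of "norm (b \<xi> - a \<xi>)"] by linarith
qed simp

text \<open>Transitivity needs both halves. From \<open>x x\<^sup>* = x y\<^sup>*\<close>, which is the half for the adjoints, \<open>x\<^sup>*\<close>
  vanishes wherever \<open>y\<^sup>*\<close> does, in particular on the range of \<open>z - y\<close>.\<close>

lemma left_star_le_trans:
  assumes x: "x \<in> bounded_ops" and y: "y \<in> bounded_ops"
    and xy: "left_star_le x y" "left_star_le (x\<^sup>\<dagger>) (y\<^sup>\<dagger>)" and yz: "left_star_le y z"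
  shows "left_star_le x z"
proof -
  have ker: "(x\<^sup>\<dagger>) \<zeta> = 0" if "(y\<^sup>\<dagger>) \<zeta> = 0" for \<zeta>
  proof -
    have "cinner ((x\<^sup>\<dagger>) \<zeta>) ((x\<^sup>\<dagger>) \<zeta>) = 0"
      using left_star_le_cinner(1)[OF xy(2) cadjoint_bounded_ops[OF x], of \<zeta> \<zeta>] that by simp
    then show ?thesis by simp
  qed
  have "(y\<^sup>\<dagger>) (z \<eta> - y \<eta>) = 0" for \<eta>
    using arg_cong[OF yz[unfolded left_star_le_def], of "\<lambda>T. T \<eta>"] by (simp add: blinfun.diff_right)
  then have "(x\<^sup>\<dagger>) (z \<eta> - y \<eta>) = 0" for \<eta> using ker by blast
  then have "x\<^sup>\<dagger> o\<^sub>L y = x\<^sup>\<dagger> o\<^sub>L z" by (intro blinfun_eqI) (simp add: blinfun.diff_right)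
  then show ?thesis using xy(1) by (simp add: left_star_le_def)
qed

lemma poset_star_le:
  assumes M: "M \<subseteq> bounded_ops" shows "poset M star_le"
  unfolding poset_def
proof (intro conjI)
  show "reflp_on M star_le" by (auto intro!: reflp_onI simp: star_le_def)
  show "transp_on M star_le"
  proof (rule transp_onI)
    fix x y z assume *: "x \<in> M" "y \<in> M" "z \<in> M" "x \<preceq>\<^sub>\<star> y" "y \<preceq>\<^sub>\<star> z"
    then have B: "x \<in> bounded_ops" "y \<in> bounded_ops" "z \<in> bounded_ops" using M by auto
    show "x \<preceq>\<^sub>\<star> z"
      using *(4,5) unfolding star_le_iff_left_star_le[OF B(1,2)] star_le_iff_left_star_le[OF B(2,3)]
        star_le_iff_left_star_le[OF B(1,3)]
      by (auto intro: left_star_le_trans[OF B(1,2)]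
          left_star_le_trans[OF B(1,2)[THEN cadjoint_bounded_ops]] simp: cadjoint_cadjoint B)
  qed
  show "antisymp_on M star_le"
  proof (rule antisymp_onI)
    fix x y assume *: "x \<in> M" "y \<in> M" "x \<preceq>\<^sub>\<star> y" "y \<preceq>\<^sub>\<star> x"
    then have B: "x \<in> bounded_ops" "y \<in> bounded_ops" using M by auto
    then have L: "left_star_le x y" "left_star_le y x" using * by (auto simp: star_le_iff_left_star_le)
    have "(norm (y \<xi> - x \<xi>))\<^sup>2 \<le> 0" for \<xi>
      using left_star_le_norm_diff[OF L(1) B(1), of \<xi>] left_star_le_norm_diff[OF L(2) B(2), of \<xi>]
      using zero_le_power2[of "norm (x \<xi> - y \<xi>)"] by linarith
    then show "x = y" by (intro blinfun_eqI) simp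
  qed
qed

section \<open>Strong limits of monotone nets\<close>

lemma eventually_ge_net_filter:
  assumes "directed_set I r" "i \<in> I"
  shows "eventually (\<lambda>j. j \<in> I \<and> r i j) (net_filter I r)"
  unfolding eventually_net_filter[OF assms(1)] using assms(2) by blast

lemma eventually_in_net_filter:
  assumes "directed_set I r" shows "eventually (\<lambda>i. i \<in> I) (net_filter I r)"
proof -
  obtain i where "i \<in> I" using assms unfolding directed_set_def by blast
  from eventually_ge_net_filter[OF assms this] show ?thesis by (rule eventually_mono) blast
qed

lemma net_filter_neq_bot:
  assumes I: "directed_set I r" shows "net_filter I r \<noteq> bot"
proof -
  have "r i i" if "i \<in> I" for i using I that unfolding directed_set_def reflp_on_def by blast
  then show ?thesis unfolding trivial_limit_def eventually_net_filter[OF I] by blast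
qed

text \<open>Any index at which \<open>f\<close> comes within \<open>e\<close> of its supremum will do.\<close>

lemma bounded_above_near_supremum:
  fixes f :: "'i \<Rightarrow> real"
  assumes "I \<noteq> {}" and "\<And>i. i \<in> I \<Longrightarrow> f i \<le> K" and "0 < e"
  obtains i where "i \<in> I" "\<And>j. j \<in> I \<Longrightarrow> f j < f i + e"
proof -
  have bdd: "bdd_above (f ` I)" using assms(2) by (rule bdd_aboveI2)
  have ub: "f j \<le> Sup (f ` I)" if "j \<in> I" for j by (rule cSup_upper[OF imageI[OF that] bdd])
  have "f ` I \<noteq> {}" using assms(1) by simp
  moreover have "Sup (f ` I) - e < Sup (f ` I)" using assms(3) by simp
  ultimately have "\<exists>x\<in>f ` I. Sup (f ` I) - e < x" using less_cSup_iff[OF _ bdd] by blast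
  then obtain i where i: "i \<in> I" "Sup (f ` I) - e < f i" by blast
  have "f j < f i + e" if "j \<in> I" for j using ub[OF that] i(2) by linarith
  with i(1) show thesis by (rule that)
qed

text \<open>Completeness provides the limit at each vector. The bound is required from an index \<open>i0\<close> on only,
  because a decreasing net need not be bounded as a whole.\<close>

lemma strong_limit_exists:
  fixes T :: "'i \<Rightarrow> 'h::chilbert_space \<Rightarrow>\<^sub>L 'h"
  assumes I: "directed_set I r" and T: "\<And>i. i \<in> I \<Longrightarrow> T i \<in> bounded_ops"
    and i0: "i0 \<in> I" and bd: "\<And>i \<xi>. i \<in> I \<Longrightarrow> r i0 i \<Longrightarrow> norm (T i \<xi>) \<le> norm \<xi> * K"
    and Cauchy: "\<And>\<xi> e. 0 < e \<Longrightarrow> \<exists>i\<in>I. \<forall>j\<in>I. r i j \<longrightarrow> norm (T j \<xi> - T i \<xi>) < e"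
  obtains S where "S \<in> bounded_ops" "\<And>\<xi>. ((\<lambda>i. T i \<xi>) \<longlongrightarrow> S \<xi>) (net_filter I r)"
proof -
  let ?F = "net_filter I r"
  note nb = net_filter_neq_bot[OF I]
  have "\<exists>v. ((\<lambda>i. T i \<xi>) \<longlongrightarrow> v) ?F" for \<xi>
  proof -
    have "cauchy_filter (filtermap (\<lambda>i. T i \<xi>) ?F)"
      unfolding cauchy_filter_metric_filtermap
    proof (intro allI impI)
      fix e :: real assume "0 < e"
      then obtain i where i: "i \<in> I" "\<forall>j\<in>I. r i j \<longrightarrow> norm (T j \<xi> - T i \<xi>) < e / 2"
        using Cauchy[of "e / 2" \<xi>] by auto
      have "dist (T j \<xi>) (T k \<xi>) < e" if "j \<in> I \<and> r i j" "k \<in> I \<and> r i k" for j k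
        using i(2) that by (intro dist_triangle_half_l[of "T j \<xi>" "T i \<xi>" e "T k \<xi>"]) (auto simp: dist_norm)
      then show "\<exists>P. eventually P ?F \<and> (\<forall>j k. P j \<and> P k \<longrightarrow> dist (T j \<xi>) (T k \<xi>) < e)"
        using eventually_ge_net_filter[OF I i(1)]
        by (intro exI[of _ "\<lambda>j. j \<in> I \<and> r i j"] conjI) blast+
    qed
    moreover have "complete (UNIV :: 'h set)"
      by (meson Cauchy_convergent UNIV_I complete_def convergent_def)
    ultimately obtain v where "filtermap (\<lambda>i. T i \<xi>) ?F \<le> nhds v"
      using nb unfolding complete_uniform by (metis UNIV_I filtermap_bot_iff principal_UNIV top_greatest)
    then show ?thesis by (auto simp: filterlim_def)
  qed
  then obtain S where S: "\<And>\<xi>. ((\<lambda>i. T i \<xi>) \<longlongrightarrow> S \<xi>) ?F" by metis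
  have scaleC_lim: "((\<lambda>i. T i (c *\<^sub>C \<xi>)) \<longlongrightarrow> c *\<^sub>C S \<xi>) ?F" for c \<xi>
  proof (rule Lim_transform_eventually)
    show "((\<lambda>i. c *\<^sub>C T i \<xi>) \<longlongrightarrow> c *\<^sub>C S \<xi>) ?F"
      by (rule bounded_linear.tendsto[OF bounded_linear_scaleC_right S])
    show "\<forall>\<^sub>F i in ?F. c *\<^sub>C T i \<xi> = T i (c *\<^sub>C \<xi>)"
      using eventually_in_net_filter[OF I] by eventually_elim (simp add: T bounded_ops_scaleC)
  qed
  have "bounded_linear S"
  proof (rule bounded_linear_intro[where K = K])
    show "S (\<xi> + \<eta>) = S \<xi> + S \<eta>" for \<xi> \<eta>
      by (rule tendsto_unique[OF nb S]) (unfold blinfun.add_right, intro tendsto_add S)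
    show "S (t *\<^sub>R \<xi>) = t *\<^sub>R S \<xi>" for t \<xi>
      by (rule tendsto_unique[OF nb S]) (unfold blinfun.scaleR_right, intro tendsto_scaleR tendsto_const S)
    show "norm (S \<xi>) \<le> norm \<xi> * K" for \<xi>
    proof (rule tendsto_upperbound[OF tendsto_norm[OF S] _ nb])
      show "\<forall>\<^sub>F i in ?F. norm (T i \<xi>) \<le> norm \<xi> * K"
        using eventually_ge_net_filter[OF I i0] by eventually_elim (simp add: bd)
    qed
  qed
  then have "blinfun_apply (Blinfun S) = S" by (rule bounded_linear_Blinfun_apply)
  moreover have "S (c *\<^sub>C \<xi>) = c *\<^sub>C S \<xi>" for c \<xi>
    by (rule tendsto_unique[OF nb S scaleC_lim])
  ultimately show thesis using S by (intro that[of "Blinfun S"]) (auto simp: bounded_ops_def)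
qed

text \<open>The strong operator topology is pulled back from the product topology, in which convergence is
  pointwise convergence.\<close>

lemma strong_limit_in_von_neumann_algebra:
  fixes M :: "('h::chilbert_space \<Rightarrow>\<^sub>L 'h) set"
  assumes M: "von_neumann_algebra M" and F: "F \<noteq> bot" and T: "eventually (\<lambda>i. T i \<in> M) F"
    and S: "S \<in> bounded_ops" and lim: "\<And>\<xi>. ((\<lambda>i. T i \<xi>) \<longlongrightarrow> S \<xi>) F"
  shows "S \<in> M"
proof -
  have sub: "M \<subseteq> bounded_ops" using M by (simp add: von_neumann_algebra_def cstar_subalgebra_def)
  have "limitin (product_topology (\<lambda>_. euclidean) UNIV) (\<lambda>i. blinfun_apply (T i)) (blinfun_apply S) F"
    using lim by (simp add: limitin_componentwise)
  then have lim': "limitin euclidean (\<lambda>i. blinfun_apply (T i)) (blinfun_apply S) F"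
    by (simp only: euclidean_product_topology)
  have "limitin strong_operator_topology T S F"
    unfolding limitin_def
  proof (intro conjI allI impI)
    show "S \<in> topspace strong_operator_topology" by (simp add: strong_operator_topology_topspace)
    fix U assume "openin strong_operator_topology U \<and> S \<in> U"
    then obtain V where V: "openin euclidean V" "U = blinfun_apply -` V" "S \<in> U"
      by (auto simp: strong_operator_topology_def openin_pullback_topology)
    then have "\<forall>\<^sub>F i in F. blinfun_apply (T i) \<in> V" using lim' unfolding limitin_def by blast
    then show "\<forall>\<^sub>F i in F. T i \<in> U" by (simp add: V(2))
  qed
  moreover have "\<forall>\<^sub>F i in F. T i \<in> bounded_ops"
    using T by eventually_elim (use sub in blast)
  ultimately have "limitin (subtopology strong_operator_topology bounded_ops) T S F"
    using S by (simp add: limitin_subtopology)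
  then show ?thesis
    by (rule limitin_closedin) (use M T F in \<open>simp_all add: von_neumann_algebra_def\<close>)
qed

text \<open>Both sides of the half order pass to strong limits. The left side occurs twice in
  \<open>cinner (a \<xi>) (a \<eta>)\<close>, which is harmless because the inner product is jointly continuous.\<close>

lemma left_star_le_limit_right:
  fixes T :: "'i \<Rightarrow> 'h::chilbert_space \<Rightarrow>\<^sub>L 'h" and S :: "'h \<Rightarrow>\<^sub>L 'h"
  assumes a: "a \<in> bounded_ops" and F: "F \<noteq> bot"
    and le: "eventually (\<lambda>i. left_star_le a (T i)) F"
    and lim: "\<And>\<xi>. ((\<lambda>i. T i \<xi>) \<longlongrightarrow> S \<xi>) F"
  shows "left_star_le a S"
proof -
  have "cinner (a \<xi>) (a \<eta>) = cinner (a \<xi>) (S \<eta>)" for \<xi> \<eta>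
  proof (rule tendsto_unique[OF F])
    show "((\<lambda>i. cinner (a \<xi>) (T i \<eta>)) \<longlongrightarrow> cinner (a \<xi>) (S \<eta>)) F"
      by (rule tendsto_cinner[OF tendsto_const lim])
    have "eventually (\<lambda>i. cinner (a \<xi>) (T i \<eta>) = cinner (a \<xi>) (a \<eta>)) F"
      using le by eventually_elim (rule left_star_le_cinner(1)[OF _ a])
    then show "((\<lambda>i. cinner (a \<xi>) (T i \<eta>)) \<longlongrightarrow> cinner (a \<xi>) (a \<eta>)) F"
      by (rule tendsto_eventually)
  qed
  then show ?thesis unfolding left_star_le_iff_cinner[OF a] by blast
qed

lemma left_star_le_limit_left:
  fixes T :: "'i \<Rightarrow> 'h::chilbert_space \<Rightarrow>\<^sub>L 'h" and S :: "'h \<Rightarrow>\<^sub>L 'h"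
  assumes S: "S \<in> bounded_ops" and F: "F \<noteq> bot"
    and le: "eventually (\<lambda>i. T i \<in> bounded_ops \<and> left_star_le (T i) b) F"
    and lim: "\<And>\<xi>. ((\<lambda>i. T i \<xi>) \<longlongrightarrow> S \<xi>) F"
  shows "left_star_le S b"
proof -
  have "cinner (S \<xi>) (S \<eta>) = cinner (S \<xi>) (b \<eta>)" for \<xi> \<eta>
  proof (rule tendsto_unique[OF F])
    show "((\<lambda>i. cinner (T i \<xi>) (T i \<eta>)) \<longlongrightarrow> cinner (S \<xi>) (S \<eta>)) F"
      by (rule tendsto_cinner[OF lim lim])
    show "((\<lambda>i. cinner (T i \<xi>) (T i \<eta>)) \<longlongrightarrow> cinner (S \<xi>) (b \<eta>)) F"
    proof (rule Lim_transform_eventually)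
      show "((\<lambda>i. cinner (T i \<xi>) (b \<eta>)) \<longlongrightarrow> cinner (S \<xi>) (b \<eta>)) F"
        by (rule tendsto_cinner[OF lim tendsto_const])
      show "eventually (\<lambda>i. cinner (T i \<xi>) (b \<eta>) = cinner (T i \<xi>) (T i \<eta>)) F"
        using le by eventually_elim (rule left_star_le_cinner(1), blast+)
    qed
  qed
  then show ?thesis unfolding left_star_le_iff_cinner[OF S] by blast
qed

text \<open>Along a monotone net, \<open>\<parallel>T\<^sub>j \<xi> - T\<^sub>i \<xi>\<parallel>\<^sup>2\<close> is the difference of the two values of the monotone
  bounded function \<open>i \<mapsto> \<parallel>T\<^sub>i \<xi>\<parallel>\<^sup>2\<close>, so the net is pointwise Cauchy.\<close>

lemma left_star_chain_strong_limit:
  fixes T :: "'i \<Rightarrow> 'h::chilbert_space \<Rightarrow>\<^sub>L 'h"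
  assumes I: "directed_set I r" and T: "\<And>i. i \<in> I \<Longrightarrow> T i \<in> bounded_ops"
    and chain: "monotone_on I r left_star_le T \<or> monotone_on I r (\<lambda>a b. left_star_le b a) T"
    and i0: "i0 \<in> I" and le: "\<And>i. i \<in> I \<Longrightarrow> r i0 i \<Longrightarrow> left_star_le (T i) c"
  obtains S where "S \<in> bounded_ops" "\<And>\<xi>. ((\<lambda>i. T i \<xi>) \<longlongrightarrow> S \<xi>) (net_filter I r)"
proof -
  define J where "J = {i \<in> I. r i0 i}"
  have J: "J \<subseteq> I" by (auto simp: J_def)
  have "r i0 i0" using I i0 by (auto simp: directed_set_def dest: reflp_onD)
  then have J_ne: "J \<noteq> {}" using i0 by (auto simp: J_def)
  have up: "j \<in> J" if "i \<in> J" "j \<in> I" "r i j" for i j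
    using that I i0 transp_onD[of I r i0 i j] by (auto simp: J_def directed_set_def)
  have bound: "norm (T i \<xi>) \<le> norm (c \<xi>)" if "i \<in> J" for i \<xi>
    using that le T by (intro left_star_le_norm_le) (auto simp: J_def)
  have Cauchy: "\<exists>i\<in>I. \<forall>j\<in>I. r i j \<longrightarrow> norm (T j \<xi> - T i \<xi>) < e" if e: "0 < e" for \<xi> e
  proof -
    have "\<exists>i\<in>J. \<forall>j\<in>I. r i j \<longrightarrow> (norm (T j \<xi> - T i \<xi>))\<^sup>2 < e\<^sup>2"
      using chain
    proof
      assume inc: "monotone_on I r left_star_le T"
      have b: "(norm (T i \<xi>))\<^sup>2 \<le> (norm (c \<xi>))\<^sup>2" if "i \<in> J" for i
        by (rule power_mono[OF bound[OF that] norm_ge_zero])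
      obtain i where i: "i \<in> J" "\<And>j. j \<in> J \<Longrightarrow> (norm (T j \<xi>))\<^sup>2 < (norm (T i \<xi>))\<^sup>2 + e\<^sup>2"
        using bounded_above_near_supremum[where e = "e\<^sup>2" and f = "\<lambda>i. (norm (T i \<xi>))\<^sup>2", OF J_ne b] e
        by auto
      have "(norm (T j \<xi> - T i \<xi>))\<^sup>2 < e\<^sup>2" if j: "j \<in> I" "r i j" for j
      proof -
        have iI: "i \<in> I" using i(1) J by blast
        show ?thesis
          using left_star_le_norm_diff[OF monotone_onD[OF inc iI j] T[OF iI], of \<xi>]
            i(2)[OF up[OF i(1) j]] by linarith
      qed
      then show ?thesis using i(1) by blast
    next
      assume dec: "monotone_on I r (\<lambda>a b. left_star_le b a) T"
      have b: "- (norm (T i \<xi>))\<^sup>2 \<le> 0" if "i \<in> J" for i by simp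
      obtain i where i: "i \<in> J" "\<And>j. j \<in> J \<Longrightarrow> - (norm (T j \<xi>))\<^sup>2 < - (norm (T i \<xi>))\<^sup>2 + e\<^sup>2"
        using bounded_above_near_supremum[where e = "e\<^sup>2" and f = "\<lambda>i. - (norm (T i \<xi>))\<^sup>2", OF J_ne b] e
        by auto
      have "(norm (T j \<xi> - T i \<xi>))\<^sup>2 < e\<^sup>2" if j: "j \<in> I" "r i j" for j
      proof -
        have iI: "i \<in> I" using i(1) J by blast
        show ?thesis
          using left_star_le_norm_diff[OF monotone_onD[OF dec iI j] T[OF j(1)], of \<xi>]
            i(2)[OF up[OF i(1) j]] by (simp add: norm_minus_commute)
      qed
      then show ?thesis using i(1) by blast
    qed
    then show ?thesis using e J by (meson less_imp_le power2_less_imp_less subsetD)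
  qed
  have "norm (T i \<xi>) \<le> norm \<xi> * norm c" if "i \<in> I" "r i0 i" for i \<xi>
    using bound[of i \<xi>] norm_blinfun[of c \<xi>] that by (simp add: J_def mult.commute)
  from strong_limit_exists[OF I T i0 this Cauchy] show thesis using that by blast
qed

lemma von_neumann_algebraD:
  assumes "von_neumann_algebra M"
  shows von_neumann_algebra_bounded_ops: "x \<in> M \<Longrightarrow> x \<in> bounded_ops"
    and von_neumann_algebra_add: "x \<in> M \<Longrightarrow> y \<in> M \<Longrightarrow> x + y \<in> M"
    and von_neumann_algebra_scaleR: "x \<in> M \<Longrightarrow> t *\<^sub>R x \<in> M"
    and von_neumann_algebra_diff: "x \<in> M \<Longrightarrow> y \<in> M \<Longrightarrow> x - y \<in> M"
    and von_neumann_algebra_comp: "x \<in> M \<Longrightarrow> y \<in> M \<Longrightarrow> x o\<^sub>L y \<in> M"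
    and von_neumann_algebra_adjoint: "x \<in> M \<Longrightarrow> x\<^sup>\<dagger> \<in> M"
proof -
  have C: "cstar_subalgebra M" using assms by (simp add: von_neumann_algebra_def)
  show *: "t *\<^sub>R x \<in> M" if "x \<in> M" for t x
    using C that scaleC_of_real_blinfun[of t x] unfolding cstar_subalgebra_def by metis
  show "x - y \<in> M" if "x \<in> M" "y \<in> M"
    using C that *[of y "- 1"] unfolding cstar_subalgebra_def by (metis scaleR_minus1_left diff_conv_add_uminus)
qed (use assms in \<open>auto simp: von_neumann_algebra_def cstar_subalgebra_def\<close>)

text \<open>Taking adjoints is not strongly continuous. Here the net of adjoints is monotone too, so it has a
  strong limit of its own, and pairing with vectors identifies that limit as the adjoint of \<open>S\<close>.\<close>

lemma star_chain_strong_limit: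
  fixes M :: "('h::chilbert_space \<Rightarrow>\<^sub>L 'h) set"
  assumes M: "von_neumann_algebra M" and I: "directed_set I r" and T: "\<And>i. i \<in> I \<Longrightarrow> T i \<in> M"
    and chain: "monotone_on I r star_le T \<or> monotone_on I r (\<lambda>a b. star_le b a) T"
    and i0: "i0 \<in> I" and c: "c \<in> M" and le: "\<And>i. i \<in> I \<Longrightarrow> r i0 i \<Longrightarrow> T i \<preceq>\<^sub>\<star> c"
  obtains S where "S \<in> M" "\<And>\<xi>. ((\<lambda>i. T i \<xi>) \<longlongrightarrow> S \<xi>) (net_filter I r)"
    "\<And>\<xi>. ((\<lambda>i. ((T i)\<^sup>\<dagger>) \<xi>) \<longlongrightarrow> (S\<^sup>\<dagger>) \<xi>) (net_filter I r)"
proof -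
  let ?F = "net_filter I r"
  note nb = net_filter_neq_bot[OF I]
  note B = von_neumann_algebra_bounded_ops[OF M]
  have TB: "T i \<in> bounded_ops" if "i \<in> I" for i using B T that by blast
  note star = star_le_iff_left_star_le[OF TB B[OF c]] star_le_iff_left_star_le[OF TB TB]
  have le1: "left_star_le (T i) c" "left_star_le ((T i)\<^sup>\<dagger>) (c\<^sup>\<dagger>)" if "i \<in> I" "r i0 i" for i
    using le[OF that] star(1) that(1) by auto
  have chain1: "monotone_on I r left_star_le T \<or> monotone_on I r (\<lambda>a b. left_star_le b a) T"
    "monotone_on I r left_star_le (\<lambda>i. (T i)\<^sup>\<dagger>) \<or> monotone_on I r (\<lambda>a b. left_star_le b a) (\<lambda>i. (T i)\<^sup>\<dagger>)"
    using chain star(2) unfolding monotone_on_def by blast+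
  obtain S where S: "S \<in> bounded_ops" "\<And>\<xi>. ((\<lambda>i. T i \<xi>) \<longlongrightarrow> S \<xi>) ?F"
    using left_star_chain_strong_limit[OF I TB chain1(1) i0 le1(1)] by blast
  obtain S' where S': "S' \<in> bounded_ops" "\<And>\<xi>. ((\<lambda>i. ((T i)\<^sup>\<dagger>) \<xi>) \<longlongrightarrow> S' \<xi>) ?F"
    using left_star_chain_strong_limit[OF I cadjoint_bounded_ops[OF TB] chain1(2) i0 le1(2)] by blast
  have adj: "S\<^sup>\<dagger> = S'"
  proof (rule cadjoint_unique, rule tendsto_unique[OF nb])
    fix \<xi> \<eta>
    show "((\<lambda>i. cinner (T i \<xi>) \<eta>) \<longlongrightarrow> cinner (S \<xi>) \<eta>) ?F"
      by (rule tendsto_cinner[OF S(2) tendsto_const])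
    show "((\<lambda>i. cinner (T i \<xi>) \<eta>) \<longlongrightarrow> cinner \<xi> (S' \<eta>)) ?F"
    proof (rule Lim_transform_eventually)
      show "((\<lambda>i. cinner \<xi> (((T i)\<^sup>\<dagger>) \<eta>)) \<longlongrightarrow> cinner \<xi> (S' \<eta>)) ?F"
        by (rule tendsto_cinner[OF tendsto_const S'(2)])
      show "\<forall>\<^sub>F i in ?F. cinner \<xi> (((T i)\<^sup>\<dagger>) \<eta>) = cinner (T i \<xi>) \<eta>"
        using eventually_in_net_filter[OF I] by eventually_elim (rule cinner_cadjoint_right[OF TB])
    qed
  qed
  have "S \<in> M"
  proof (rule strong_limit_in_von_neumann_algebra[OF M nb _ S])
    show "\<forall>\<^sub>F i in ?F. T i \<in> M" using eventually_in_net_filter[OF I] by eventually_elim (rule T)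
  qed
  then show thesis using S(2) S'(2) adj that by blast
qed

text \<open>The strong limit of an increasing net is an upper bound of it and lies below every other upper
  bound, because orthogonality relations pass to strong limits.\<close>

lemma star_supremum_strong_limit:
  fixes M :: "('h::chilbert_space \<Rightarrow>\<^sub>L 'h) set"
  assumes M: "von_neumann_algebra M" and I: "directed_set I r" and T: "T ` I \<subseteq> M"
    and inc: "monotone_on I r star_le T" and sup: "is_supremum M star_le (T ` I) x"
  shows "((\<lambda>i. T i \<xi>) \<longlongrightarrow> x \<xi>) (net_filter I r)"
    and "((\<lambda>i. ((T i)\<^sup>\<dagger>) \<xi>) \<longlongrightarrow> (x\<^sup>\<dagger>) \<xi>) (net_filter I r)"
proof -
  let ?F = "net_filter I r"
  note nb = net_filter_neq_bot[OF I] and ev = eventually_in_net_filter[OF I]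
  have xM: "x \<in> M" and Tx: "\<And>i. i \<in> I \<Longrightarrow> T i \<preceq>\<^sub>\<star> x" using sup by (auto simp: is_supremum_def)
  have TM: "T i \<in> M" if "i \<in> I" for i using T that by blast
  note B = von_neumann_algebra_bounded_ops[OF M]
  obtain i0 where i0: "i0 \<in> I" using I unfolding directed_set_def by blast
  obtain S where S: "S \<in> M" "\<And>\<xi>. ((\<lambda>i. T i \<xi>) \<longlongrightarrow> S \<xi>) ?F"
      "\<And>\<xi>. ((\<lambda>i. ((T i)\<^sup>\<dagger>) \<xi>) \<longlongrightarrow> (S\<^sup>\<dagger>) \<xi>) ?F"
    using star_chain_strong_limit[OF M I TM disjI1[OF inc] i0 xM Tx] by blast
  note star = star_le_iff_left_star_le[OF B B]
  have "T i \<preceq>\<^sub>\<star> S" if i: "i \<in> I" for i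
  proof -
    have "left_star_le (T i) (T j) \<and> left_star_le ((T i)\<^sup>\<dagger>) ((T j)\<^sup>\<dagger>)" if "j \<in> I" "r i j" for j
      using monotone_onD[OF inc i that] star[OF TM[OF i] TM[OF that(1)]] by blast
    then have "\<forall>\<^sub>F j in ?F. left_star_le (T i) (T j) \<and> left_star_le ((T i)\<^sup>\<dagger>) ((T j)\<^sup>\<dagger>)"
      using eventually_ge_net_filter[OF I i] by (auto elim: eventually_mono)
    then show ?thesis
      using left_star_le_limit_right[OF B[OF TM[OF i]] nb _ S(2)]
        left_star_le_limit_right[OF cadjoint_bounded_ops[OF B[OF TM[OF i]]] nb _ S(3)]
      by (simp add: star[OF TM[OF i] S(1)] eventually_conj_iff)
  qed
  then have "x \<preceq>\<^sub>\<star> S" using sup S(1) unfolding is_supremum_def by blast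
  moreover have "S \<preceq>\<^sub>\<star> x"
  proof -
    have "\<forall>\<^sub>F i in ?F. T i \<in> bounded_ops \<and> left_star_le (T i) x"
      "\<forall>\<^sub>F i in ?F. (T i)\<^sup>\<dagger> \<in> bounded_ops \<and> left_star_le ((T i)\<^sup>\<dagger>) (x\<^sup>\<dagger>)"
      using ev by (eventually_elim, use Tx star[OF TM xM] B[OF TM] cadjoint_bounded_ops in blast)+
    then show ?thesis
      using left_star_le_limit_left[OF B[OF S(1)] nb _ S(2)]
        left_star_le_limit_left[OF cadjoint_bounded_ops[OF B[OF S(1)]] nb _ S(3)]
      by (simp add: star[OF S(1) xM])
  qed
  ultimately have "S = x"
    using poset_star_le[of M] B S(1) xM unfolding poset_def by (blast dest: antisymp_onD)
  then show "((\<lambda>i. T i \<xi>) \<longlongrightarrow> x \<xi>) ?F" "((\<lambda>i. ((T i)\<^sup>\<dagger>) \<xi>) \<longlongrightarrow> (x\<^sup>\<dagger>) \<xi>) ?F" using S by auto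
qed

text \<open>The dual statement. A decreasing net is bounded only from an index \<open>i0\<close> on, by its own value
  there.\<close>

lemma star_infimum_strong_limit:
  fixes M :: "('h::chilbert_space \<Rightarrow>\<^sub>L 'h) set"
  assumes M: "von_neumann_algebra M" and I: "directed_set I r" and T: "T ` I \<subseteq> M"
    and dec: "monotone_on I r (\<lambda>a b. star_le b a) T" and inf: "is_infimum M star_le (T ` I) x"
  shows "((\<lambda>i. T i \<xi>) \<longlongrightarrow> x \<xi>) (net_filter I r)"
    and "((\<lambda>i. ((T i)\<^sup>\<dagger>) \<xi>) \<longlongrightarrow> (x\<^sup>\<dagger>) \<xi>) (net_filter I r)"
proof -
  let ?F = "net_filter I r"
  note nb = net_filter_neq_bot[OF I] and ev = eventually_in_net_filter[OF I]
  have xM: "x \<in> M" and xT: "\<And>i. i \<in> I \<Longrightarrow> x \<preceq>\<^sub>\<star> T i" using inf by (auto simp: is_infimum_def)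
  have TM: "T i \<in> M" if "i \<in> I" for i using T that by blast
  note B = von_neumann_algebra_bounded_ops[OF M]
  obtain i0 where i0: "i0 \<in> I" using I unfolding directed_set_def by blast
  obtain S where S: "S \<in> M" "\<And>\<xi>. ((\<lambda>i. T i \<xi>) \<longlongrightarrow> S \<xi>) ?F"
      "\<And>\<xi>. ((\<lambda>i. ((T i)\<^sup>\<dagger>) \<xi>) \<longlongrightarrow> (S\<^sup>\<dagger>) \<xi>) ?F"
    using star_chain_strong_limit[OF M I TM disjI2[OF dec] i0 TM[OF i0] monotone_onD[OF dec i0]] by blast
  note star = star_le_iff_left_star_le[OF B B]
  have "S \<preceq>\<^sub>\<star> T i" if i: "i \<in> I" for i
  proof -
    have "T j \<in> bounded_ops \<and> left_star_le (T j) (T i)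
        \<and> (T j)\<^sup>\<dagger> \<in> bounded_ops \<and> left_star_le ((T j)\<^sup>\<dagger>) ((T i)\<^sup>\<dagger>)" if "j \<in> I" "r i j" for j
      using monotone_onD[OF dec i that] star[OF TM[OF that(1)] TM[OF i]] B[OF TM[OF that(1)]]
        cadjoint_bounded_ops by blast
    then have "\<forall>\<^sub>F j in ?F. T j \<in> bounded_ops \<and> left_star_le (T j) (T i)
        \<and> (T j)\<^sup>\<dagger> \<in> bounded_ops \<and> left_star_le ((T j)\<^sup>\<dagger>) ((T i)\<^sup>\<dagger>)"
      using eventually_ge_net_filter[OF I i] by (auto elim: eventually_mono)
    then show ?thesis
      using left_star_le_limit_left[OF B[OF S(1)] nb _ S(2)]
        left_star_le_limit_left[OF cadjoint_bounded_ops[OF B[OF S(1)]] nb _ S(3)]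
      by (simp add: star[OF S(1) TM[OF i]] eventually_conj_iff)
  qed
  then have "S \<preceq>\<^sub>\<star> x" using inf S(1) unfolding is_infimum_def by blast
  moreover have "x \<preceq>\<^sub>\<star> S"
  proof -
    have "\<forall>\<^sub>F i in ?F. left_star_le x (T i)" "\<forall>\<^sub>F i in ?F. left_star_le (x\<^sup>\<dagger>) ((T i)\<^sup>\<dagger>)"
      using ev by (eventually_elim, use xT star[OF xM TM] in blast)+
    then show ?thesis
      using left_star_le_limit_right[OF B[OF xM] nb _ S(2)]
        left_star_le_limit_right[OF cadjoint_bounded_ops[OF B[OF xM]] nb _ S(3)]
      by (simp add: star[OF xM S(1)])
  qed
  ultimately have "S = x"
    using poset_star_le[of M] B S(1) xM unfolding poset_def by (blast dest: antisymp_onD)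
  then show "((\<lambda>i. T i \<xi>) \<longlongrightarrow> x \<xi>) ?F" "((\<lambda>i. ((T i)\<^sup>\<dagger>) \<xi>) \<longlongrightarrow> (x\<^sup>\<dagger>) \<xi>) ?F" using S by auto
qed

section \<open>Normal positive functionals\<close>

lemma bounded_functional_diff:
  assumes M: "von_neumann_algebra M" and \<phi>: "bounded_functional M \<phi>" and "x \<in> M" "y \<in> M"
  shows "\<phi> (x - y) = \<phi> x - \<phi> y"
proof -
  have "\<phi> ((x - y) + y) = \<phi> (x - y) + \<phi> y"
    using \<phi> assms(3,4) von_neumann_algebra_diff[OF M assms(3,4)] unfolding bounded_functional_def by blast
  then show ?thesis by simp
qed

lemma bounded_functional_add:
  "bounded_functional M \<phi> \<Longrightarrow> x \<in> M \<Longrightarrow> y \<in> M \<Longrightarrow> \<phi> (x + y) = \<phi> x + \<phi> y"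
  by (simp add: bounded_functional_def)

lemma bounded_functional_scaleR:
  "bounded_functional M \<phi> \<Longrightarrow> x \<in> M \<Longrightarrow> \<phi> (t *\<^sub>R x) = complex_of_real t * \<phi> x"
  by (simp add: bounded_functional_def flip: scaleC_of_real_blinfun)

lemma directed_set_image:
  assumes I: "directed_set I r" and mono: "monotone_on I r le h"
    and refl: "\<And>a. le a a" and trans: "\<And>a b c. le a b \<Longrightarrow> le b c \<Longrightarrow> le a c"
  shows "directed_set (h ` I) le"
  unfolding directed_set_def
proof (intro conjI ballI)
  show "h ` I \<noteq> {}" using I by (auto simp: directed_set_def)
  show "reflp_on (h ` I) le" by (rule reflp_onI) (rule refl)
  show "transp_on (h ` I) le" by (rule transp_onI) (rule trans)
  fix a b assume "a \<in> h ` I" "b \<in> h ` I"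
  then obtain i j where ij: "i \<in> I" "j \<in> I" "a = h i" "b = h j" by blast
  then obtain k where k: "k \<in> I" "r i k" "r j k" using I unfolding directed_set_def by blast
  then show "\<exists>c\<in>h ` I. le a c \<and> le b c"
    using monotone_onD[OF mono ij(1) k(1,2)] monotone_onD[OF mono ij(2) k(1,3)] ij by blast
qed

lemma op_le_iff: "op_le a b \<longleftrightarrow> (\<forall>\<xi>. cinner \<xi> (b \<xi>) - cinner \<xi> (a \<xi>) \<in> \<real>\<^sub>\<ge>\<^sub>0)"
  by (simp add: op_le_def blinfun.diff_left cinner_diff_right)

lemma op_le_trans: "op_le a b \<Longrightarrow> op_le b c \<Longrightarrow> op_le a c"
  unfolding op_le_iff
proof
  fix \<xi> assume "\<forall>\<xi>. cinner \<xi> (b \<xi>) - cinner \<xi> (a \<xi>) \<in> \<real>\<^sub>\<ge>\<^sub>0"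
    "\<forall>\<xi>. cinner \<xi> (c \<xi>) - cinner \<xi> (b \<xi>) \<in> \<real>\<^sub>\<ge>\<^sub>0"
  then have "(cinner \<xi> (b \<xi>) - cinner \<xi> (a \<xi>)) + (cinner \<xi> (c \<xi>) - cinner \<xi> (b \<xi>)) \<in> \<real>\<^sub>\<ge>\<^sub>0"
    by (intro nonneg_Reals_add_I) blast+
  then show "cinner \<xi> (c \<xi>) - cinner \<xi> (a \<xi>) \<in> \<real>\<^sub>\<ge>\<^sub>0" by simp
qed

text \<open>The weak limit of an increasing net is its supremum, since \<open>\<real>\<^sub>\<ge>\<^sub>0\<close> is closed. Normality then applies
  to the range of the net, and monotonicity carries convergence along the range back to the net.\<close>

lemma normal_functional_tendsto:
  fixes M :: "('h::chilbert_space \<Rightarrow>\<^sub>L 'h) set"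
  assumes \<phi>: "normal_functional M \<phi>" and I: "directed_set I r"
    and h: "h ` I \<subseteq> selfadjoint_part M" and mono: "monotone_on I r op_le h"
    and a: "a \<in> selfadjoint_part M"
    and lim: "\<And>\<xi>. ((\<lambda>i. cinner \<xi> (h i \<xi>)) \<longlongrightarrow> cinner \<xi> (a \<xi>)) (net_filter I r)"
  shows "((\<lambda>i. \<phi> (h i)) \<longlongrightarrow> \<phi> a) (net_filter I r)"
proof -
  let ?F = "net_filter I r"
  note nb = net_filter_neq_bot[OF I]
  have dir: "directed_set (h ` I) op_le"
    by (rule directed_set_image[OF I mono _ op_le_trans]) (auto simp: op_le_iff)
  have "op_le (h i) a" if i: "i \<in> I" for i
    unfolding op_le_iff
  proof
    fix \<xi>
    show "cinner \<xi> (a \<xi>) - cinner \<xi> (h i \<xi>) \<in> \<real>\<^sub>\<ge>\<^sub>0"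
    proof (rule Lim_in_closed_set[OF closed_nonneg_Reals_complex _ nb])
      show "((\<lambda>j. cinner \<xi> (h j \<xi>) - cinner \<xi> (h i \<xi>)) \<longlongrightarrow> cinner \<xi> (a \<xi>) - cinner \<xi> (h i \<xi>)) ?F"
        by (rule tendsto_diff[OF lim tendsto_const])
      show "\<forall>\<^sub>F j in ?F. cinner \<xi> (h j \<xi>) - cinner \<xi> (h i \<xi>) \<in> \<real>\<^sub>\<ge>\<^sub>0"
        using eventually_ge_net_filter[OF I i]
        by eventually_elim (use monotone_onD[OF mono i] op_le_iff in blast)
    qed
  qed
  moreover have "op_le a u" if u: "\<forall>s\<in>h ` I. op_le s u" for u
    unfolding op_le_iff
  proof
    fix \<xi>
    show "cinner \<xi> (u \<xi>) - cinner \<xi> (a \<xi>) \<in> \<real>\<^sub>\<ge>\<^sub>0"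
    proof (rule Lim_in_closed_set[OF closed_nonneg_Reals_complex _ nb])
      show "((\<lambda>j. cinner \<xi> (u \<xi>) - cinner \<xi> (h j \<xi>)) \<longlongrightarrow> cinner \<xi> (u \<xi>) - cinner \<xi> (a \<xi>)) ?F"
        by (rule tendsto_diff[OF tendsto_const lim])
      show "\<forall>\<^sub>F j in ?F. cinner \<xi> (u \<xi>) - cinner \<xi> (h j \<xi>) \<in> \<real>\<^sub>\<ge>\<^sub>0"
        using eventually_in_net_filter[OF I] by eventually_elim (use u op_le_iff in blast)
    qed
  qed
  ultimately have "is_supremum (selfadjoint_part M) op_le (h ` I) a"
    using a unfolding is_supremum_def by blast
  then have lim\<phi>: "(\<phi> \<longlongrightarrow> \<phi> a) (net_filter (h ` I) op_le)"
    using \<phi> h dir unfolding normal_functional_def by blast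
  show ?thesis
  proof (rule topological_tendstoI)
    fix U assume "open U" "\<phi> a \<in> U"
    then have "eventually (\<lambda>b. \<phi> b \<in> U) (net_filter (h ` I) op_le)"
      by (rule topological_tendstoD[OF lim\<phi>])
    then obtain i where i: "i \<in> I" "\<forall>j\<in>I. op_le (h i) (h j) \<longrightarrow> \<phi> (h j) \<in> U"
      unfolding eventually_net_filter[OF dir] by blast
    show "\<forall>\<^sub>F j in ?F. \<phi> (h j) \<in> U"
      using eventually_ge_net_filter[OF I i(1)]
      by eventually_elim (use i monotone_onD[OF mono i(1)] in blast)
  qed
qed

text \<open>The square of the seminorm \<open>a \<mapsto> \<phi> (a\<^sup>* a)\<^sup>1\<^sup>/\<^sup>2\<close> on which the GNS construction rests.\<close>

definition gns_square :: "(('h::chilbert_space \<Rightarrow>\<^sub>L 'h) \<Rightarrow> complex) \<Rightarrow> ('h \<Rightarrow>\<^sub>L 'h) \<Rightarrow> real" where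
  "gns_square \<phi> a = Re (\<phi> (a\<^sup>\<dagger> o\<^sub>L a))"

lemma gns_square_nonneg: "positive_functional M \<phi> \<Longrightarrow> a \<in> M \<Longrightarrow> 0 \<le> gns_square \<phi> a"
  by (auto simp: positive_functional_def gns_square_def complex_nonneg_Reals_iff)

lemma gns_square_uminus: "a \<in> bounded_ops \<Longrightarrow> gns_square \<phi> (- a) = gns_square \<phi> a"
proof -
  assume a: "a \<in> bounded_ops"
  have "(- a)\<^sup>\<dagger> = - (a\<^sup>\<dagger>)" using cadjoint_scaleR[OF a, of "- 1"] by simp
  then have "(- a)\<^sup>\<dagger> o\<^sub>L (- a) = a\<^sup>\<dagger> o\<^sub>L a"
    by (intro blinfun_eqI) (simp add: blinfun.minus_left blinfun.minus_right)
  then show ?thesis by (simp add: gns_square_def)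
qed

text \<open>A form of the triangle inequality: expand \<open>\<phi> ((t a - b)\<^sup>* (t a - b)) \<ge> 0\<close> and divide by \<open>t\<close>
  to bound the mixed terms.\<close>

lemma gns_square_add_le:
  assumes M: "von_neumann_algebra M" and \<phi>: "bounded_functional M \<phi>" "positive_functional M \<phi>"
    and a: "a \<in> M" and b: "b \<in> M" and t: "0 < t"
  shows "gns_square \<phi> (a + b) \<le> (1 + t) * gns_square \<phi> a + (1 + 1 / t) * gns_square \<phi> b"
proof -
  note B = von_neumann_algebra_bounded_ops[OF M]
  note cl = von_neumann_algebra_add[OF M] von_neumann_algebra_diff[OF M] von_neumann_algebra_comp[OF M]
    von_neumann_algebra_scaleR[OF M] von_neumann_algebra_adjoint[OF M]
  define p where "p = a\<^sup>\<dagger> o\<^sub>L a"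
  define q where "q = b\<^sup>\<dagger> o\<^sub>L b"
  define c where "c = (a\<^sup>\<dagger> o\<^sub>L b) + (b\<^sup>\<dagger> o\<^sub>L a)"
  have m: "p \<in> M" "q \<in> M" "c \<in> M" unfolding p_def q_def c_def by (intro cl a b)+
  have "(a + b)\<^sup>\<dagger> o\<^sub>L (a + b) = (p + c) + q"
    by (rule blinfun_eqI) (simp add: p_def q_def c_def cadjoint_add B[OF a] B[OF b]
        blinfun.add_left blinfun.add_right)
  then have 1: "gns_square \<phi> (a + b) = gns_square \<phi> a + Re (\<phi> c) + gns_square \<phi> b"
    by (simp add: gns_square_def bounded_functional_add[OF \<phi>(1)] cl m p_def[symmetric] q_def[symmetric])
  have ta: "t *\<^sub>R a \<in> M" by (rule cl(4)[OF a])
  have "(t *\<^sub>R a - b)\<^sup>\<dagger> o\<^sub>L (t *\<^sub>R a - b) = (t\<^sup>2 *\<^sub>R p - t *\<^sub>R c) + q"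
    by (rule blinfun_eqI) (simp add: p_def q_def c_def cadjoint_diff cadjoint_scaleR B[OF a] B[OF b] B[OF ta]
        blinfun.add_left blinfun.add_right blinfun.diff_left blinfun.diff_right
        blinfun.scaleR_left blinfun.scaleR_right algebra_simps power2_eq_square)
  then have "gns_square \<phi> (t *\<^sub>R a - b) = t\<^sup>2 * gns_square \<phi> a - t * Re (\<phi> c) + gns_square \<phi> b"
    by (simp add: gns_square_def bounded_functional_add[OF \<phi>(1)] bounded_functional_diff[OF M \<phi>(1)]
        bounded_functional_scaleR[OF \<phi>(1)] cl m p_def[symmetric] q_def[symmetric] flip: of_real_power)
  moreover have "t * (t * gns_square \<phi> a + gns_square \<phi> b / t) = t\<^sup>2 * gns_square \<phi> a + gns_square \<phi> b"
    using t by (simp add: distrib_left power2_eq_square)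
  ultimately have "t * Re (\<phi> c) \<le> t * (t * gns_square \<phi> a + gns_square \<phi> b / t)"
    using gns_square_nonneg[OF \<phi>(2) cl(2)[OF ta b]] by linarith
  then have "Re (\<phi> c) \<le> t * gns_square \<phi> a + gns_square \<phi> b / t"
    using t by (simp only: mult_le_cancel_left_pos)
  then show ?thesis by (simp add: 1 algebra_simps)
qed

lemma gns_square_diff_of_left_star_le:
  assumes M: "von_neumann_algebra M" and \<phi>: "bounded_functional M \<phi>"
    and a: "a \<in> M" and b: "b \<in> M" and le: "left_star_le a b"
  shows "gns_square \<phi> (b - a) = gns_square \<phi> b - gns_square \<phi> a"
  using le a b M unfolding gns_square_def
  by (simp add: left_star_le_diff_square von_neumann_algebra_bounded_ops[OF M]
      bounded_functional_diff[OF M \<phi>] von_neumann_algebra_comp[OF M] von_neumann_algebra_adjoint[OF M])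

lemma gns_square_mono:
  assumes "von_neumann_algebra M" "bounded_functional M \<phi>" "positive_functional M \<phi>"
    and "a \<in> M" "b \<in> M" "left_star_le a b"
  shows "gns_square \<phi> a \<le> gns_square \<phi> b"
  using gns_square_diff_of_left_star_le[OF assms(1,2,4-6)]
    gns_square_nonneg[OF assms(3) von_neumann_algebra_diff[OF assms(1,5,4)]] by simp

lemma selfadjoint_part_square:
  assumes M: "von_neumann_algebra M" and "a \<in> M"
  shows "t *\<^sub>R (a\<^sup>\<dagger> o\<^sub>L a) \<in> selfadjoint_part M"
proof -
  have "a \<in> bounded_ops" by (rule von_neumann_algebra_bounded_ops[OF assms])
  moreover from this have "a\<^sup>\<dagger> \<in> bounded_ops" by (rule cadjoint_bounded_ops)
  moreover have m: "a\<^sup>\<dagger> o\<^sub>L a \<in> M"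
    using assms von_neumann_algebra_comp von_neumann_algebra_adjoint by blast
  ultimately show ?thesis
    by (simp add: selfadjoint_part_def cadjoint_scaleR cadjoint_comp cadjoint_cadjoint
        von_neumann_algebra_scaleR[OF M] von_neumann_algebra_bounded_ops[OF M])
qed

lemma cinner_square:
  "a \<in> bounded_ops \<Longrightarrow> cinner \<xi> ((t *\<^sub>R (a\<^sup>\<dagger> o\<^sub>L a)) \<xi>) = complex_of_real (t * (norm (a \<xi>))\<^sup>2)"
  for a :: "'h::chilbert_space \<Rightarrow>\<^sub>L 'h"
  by (simp add: blinfun.scaleR_left cinner_scaleR_right cinner_cadjoint_right cinner_self)

text \<open>The factor \<open>s\<close> is \<open>1\<close> for increasing and \<open>- 1\<close> for decreasing nets, so that \<open>s T\<^sub>i\<^sup>* T\<^sub>i\<close> increases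
  in both cases.\<close>

lemma gns_square_tendsto_of_signed_monotone:
  fixes M :: "('h::chilbert_space \<Rightarrow>\<^sub>L 'h) set" and s :: real
  assumes M: "von_neumann_algebra M" and \<phi>: "\<phi> \<in> predual M" and I: "directed_set I r"
    and T: "T ` I \<subseteq> M" and x: "x \<in> M" and s: "s \<noteq> 0"
    and mono: "\<And>i j \<xi>. i \<in> I \<Longrightarrow> j \<in> I \<Longrightarrow> r i j \<Longrightarrow> s * (norm (T i \<xi>))\<^sup>2 \<le> s * (norm (T j \<xi>))\<^sup>2"
    and lim: "\<And>\<xi>. ((\<lambda>i. T i \<xi>) \<longlongrightarrow> x \<xi>) (net_filter I r)"
  shows "((\<lambda>i. gns_square \<phi> (T i)) \<longlongrightarrow> gns_square \<phi> x) (net_filter I r)"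
proof -
  let ?F = "net_filter I r"
  let ?sq = "\<lambda>a. s *\<^sub>R (a\<^sup>\<dagger> o\<^sub>L a)"
  have bf: "bounded_functional M \<phi>" and nf: "normal_functional M \<phi>" using \<phi> by (auto simp: predual_def)
  note B = von_neumann_algebra_bounded_ops[OF M]
  have TM: "T i \<in> M" if "i \<in> I" for i using T that by blast
  have \<phi>sq: "Re (\<phi> (?sq a)) = s * gns_square \<phi> a" if "a \<in> M" for a
    using bounded_functional_scaleR[OF bf, of "a\<^sup>\<dagger> o\<^sub>L a" s] that
      von_neumann_algebra_comp[OF M] von_neumann_algebra_adjoint[OF M]
    by (simp add: gns_square_def)
  have "((\<lambda>i. \<phi> (?sq (T i))) \<longlongrightarrow> \<phi> (?sq x)) ?F"
  proof (rule normal_functional_tendsto[OF nf I _ _ selfadjoint_part_square[OF M x]])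
    show "(\<lambda>i. ?sq (T i)) ` I \<subseteq> selfadjoint_part M"
      using TM selfadjoint_part_square[OF M] by blast
    show "monotone_on I r op_le (\<lambda>i. ?sq (T i))"
    proof (rule monotone_onI)
      fix i j assume ij: "i \<in> I" "j \<in> I" "r i j"
      show "op_le (?sq (T i)) (?sq (T j))"
        unfolding op_le_iff cinner_square[OF B[OF TM[OF ij(1)]]] cinner_square[OF B[OF TM[OF ij(2)]]]
        using mono[OF ij] by (auto simp: complex_nonneg_Reals_iff simp del: of_real_mult)
    qed
    fix \<xi>
    have "((\<lambda>i. complex_of_real (s * (norm (T i \<xi>))\<^sup>2)) \<longlongrightarrow> cinner \<xi> (?sq x \<xi>)) ?F"
      unfolding cinner_square[OF B[OF x]] by (intro tendsto_intros lim)
    then show "((\<lambda>i. cinner \<xi> (?sq (T i) \<xi>)) \<longlongrightarrow> cinner \<xi> (?sq x \<xi>)) ?F"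
    proof (rule Lim_transform_eventually)
      show "\<forall>\<^sub>F i in ?F. complex_of_real (s * (norm (T i \<xi>))\<^sup>2) = cinner \<xi> (?sq (T i) \<xi>)"
        using eventually_in_net_filter[OF I]
        by eventually_elim (rule cinner_square[OF B[OF TM], symmetric])
    qed
  qed
  then have "((\<lambda>i. inverse s * Re (\<phi> (?sq (T i)))) \<longlongrightarrow> inverse s * Re (\<phi> (?sq x))) ?F"
    by (intro tendsto_mult tendsto_const tendsto_Re)
  moreover have "inverse s * Re (\<phi> (?sq x)) = gns_square \<phi> x" using s by (simp add: \<phi>sq x)
  ultimately have "((\<lambda>i. inverse s * Re (\<phi> (?sq (T i)))) \<longlongrightarrow> gns_square \<phi> x) ?F" by simp
  moreover have "\<forall>\<^sub>F i in ?F. inverse s * Re (\<phi> (?sq (T i))) = gns_square \<phi> (T i)"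
    using eventually_in_net_filter[OF I] by eventually_elim (use s in \<open>simp add: \<phi>sq TM\<close>)
  ultimately show ?thesis by (rule Lim_transform_eventually)
qed

text \<open>With \<open>q = gns_square \<phi>\<close>, the squeeze rests on
  \<open>q (X - x) \<le> 2 q (X - A) + 2 q (x - A) \<le> 2 (q B - q A) + 2 (q x - q A)\<close>,
  in which every difference tends to \<open>0\<close> by normality.\<close>

lemma gns_square_squeeze:
  fixes M :: "('h::chilbert_space \<Rightarrow>\<^sub>L 'h) set"
  assumes M: "von_neumann_algebra M" and \<phi>: "\<phi> \<in> predual M" "positive_functional M \<phi>"
    and I: "directed_set I r"
    and inM: "\<And>i. i \<in> I \<Longrightarrow> A i \<in> M" "\<And>i. i \<in> I \<Longrightarrow> X i \<in> M" "\<And>i. i \<in> I \<Longrightarrow> B i \<in> M" "x \<in> M"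
    and le: "\<And>i. i \<in> I \<Longrightarrow> left_star_le (A i) (X i)" "\<And>i. i \<in> I \<Longrightarrow> left_star_le (X i) (B i)"
      "\<And>i. i \<in> I \<Longrightarrow> left_star_le (A i) x"
    and A: "monotone_on I r left_star_le A" "\<And>\<xi>. ((\<lambda>i. A i \<xi>) \<longlongrightarrow> x \<xi>) (net_filter I r)"
    and B: "monotone_on I r (\<lambda>a b. left_star_le b a) B" "\<And>\<xi>. ((\<lambda>i. B i \<xi>) \<longlongrightarrow> x \<xi>) (net_filter I r)"
  shows "((\<lambda>i. gns_square \<phi> (X i - x)) \<longlongrightarrow> 0) (net_filter I r)"
proof -
  let ?F = "net_filter I r"
  let ?q = "gns_square \<phi>"
  have bf: "bounded_functional M \<phi>" using \<phi>(1) by (simp add: predual_def)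
  note ops = von_neumann_algebra_bounded_ops[OF M] and diff = von_neumann_algebra_diff[OF M]
  have limA: "((\<lambda>i. ?q (A i)) \<longlongrightarrow> ?q x) ?F"
  proof (rule gns_square_tendsto_of_signed_monotone[OF M \<phi>(1) I _ inM(4) _ _ A(2), of 1])
    fix i j \<xi> assume ij: "i \<in> I" "j \<in> I" "r i j"
    show "1 * (norm (A i \<xi>))\<^sup>2 \<le> 1 * (norm (A j \<xi>))\<^sup>2"
      using left_star_le_norm_le[OF monotone_onD[OF A(1) ij] ops[OF inM(1)[OF ij(1)]], of \<xi>]
      by (simp add: power_mono)
  qed (use inM in auto)
  have limB: "((\<lambda>i. ?q (B i)) \<longlongrightarrow> ?q x) ?F"
  proof (rule gns_square_tendsto_of_signed_monotone[OF M \<phi>(1) I _ inM(4) _ _ B(2), of "- 1"])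
    fix i j \<xi> assume ij: "i \<in> I" "j \<in> I" "r i j"
    show "- 1 * (norm (B i \<xi>))\<^sup>2 \<le> - 1 * (norm (B j \<xi>))\<^sup>2"
      using left_star_le_norm_le[OF monotone_onD[OF B(1) ij] ops[OF inM(3)[OF ij(2)]], of \<xi>]
      by (simp add: power_mono)
  qed (use inM in auto)
  have upper: "?q (X i - x) \<le> 2 * (?q (B i) - ?q (A i)) + 2 * (?q x - ?q (A i))" if i: "i \<in> I" for i
  proof -
    have "?q (X i - x) = ?q ((X i - A i) + - (x - A i))" by simp
    also have "\<dots> \<le> (1 + 1) * ?q (X i - A i) + (1 + 1 / 1) * ?q (- (x - A i))"
      using diff[OF inM(1)[OF i] inM(4)]
      by (intro gns_square_add_le[OF M bf \<phi>(2)] diff inM i) simp_all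
    also have "?q (- (x - A i)) = ?q x - ?q (A i)"
      using gns_square_uminus[OF ops[OF diff[OF inM(4) inM(1)[OF i]]], of \<phi>]
        gns_square_diff_of_left_star_le[OF M bf inM(1)[OF i] inM(4) le(3)[OF i]] by simp
    also have "?q (X i - A i) = ?q (X i) - ?q (A i)"
      by (rule gns_square_diff_of_left_star_le[OF M bf inM(1)[OF i] inM(2)[OF i] le(1)[OF i]])
    finally show ?thesis
      using gns_square_mono[OF M bf \<phi>(2) inM(2)[OF i] inM(3)[OF i] le(2)[OF i]] by simp
  qed
  show ?thesis
  proof (rule tendsto_sandwich)
    show "\<forall>\<^sub>F i in ?F. 0 \<le> ?q (X i - x)"
      using eventually_in_net_filter[OF I]
      by eventually_elim (rule gns_square_nonneg[OF \<phi>(2) diff[OF inM(2) inM(4)]])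
    show "\<forall>\<^sub>F i in ?F. ?q (X i - x) \<le> 2 * (?q (B i) - ?q (A i)) + 2 * (?q x - ?q (A i))"
      using eventually_in_net_filter[OF I] by eventually_elim (rule upper)
    have "((\<lambda>i. 2 * (?q (B i) - ?q (A i)) + 2 * (?q x - ?q (A i)))
        \<longlongrightarrow> 2 * (?q x - ?q x) + 2 * (?q x - ?q x)) ?F"
      by (intro tendsto_intros limA limB)
    then show "((\<lambda>i. 2 * (?q (B i) - ?q (A i)) + 2 * (?q x - ?q (A i))) \<longlongrightarrow> 0) ?F" by simp
  qed simp
qed

section \<open>Convergence in the \<open>\<sigma>\<close>-strong* topology\<close>

lemma limitin_topology_generated_by:
  assumes x: "x \<in> \<Union>\<S>" and basic: "\<And>U. U \<in> \<S> \<Longrightarrow> x \<in> U \<Longrightarrow> eventually (\<lambda>i. X i \<in> U) F"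
  shows "limitin (topology_generated_by \<S>) X x F"
  unfolding limitin_def
proof (intro conjI allI impI)
  show "x \<in> topspace (topology_generated_by \<S>)" using x by simp
  have "x \<in> U \<longrightarrow> eventually (\<lambda>i. X i \<in> U) F" if "generate_topology_on \<S> U" for U
    using that
  proof induction
    case (UN K)
    show ?case
    proof
      assume "x \<in> \<Union>K"
      then obtain k where k: "k \<in> K" "x \<in> k" by blast
      then have "eventually (\<lambda>i. X i \<in> k) F" using UN by blast
      then show "eventually (\<lambda>i. X i \<in> \<Union>K) F" by (rule eventually_mono) (use k in blast)
    qed
  qed (auto simp: basic eventually_conj_iff)
  then show "eventually (\<lambda>i. X i \<in> U) F" if "openin (topology_generated_by \<S>) U \<and> x \<in> U" for U
    using that openin_topology_generated_by by blast
qed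

lemma sigma_strong_star_seminorm_eq:
  "x \<in> bounded_ops \<Longrightarrow>
    sigma_strong_star_seminorm \<phi> x = sqrt (gns_square \<phi> x + gns_square \<phi> (x\<^sup>\<dagger>))"
  by (simp add: sigma_strong_star_seminorm_def gns_square_def cadjoint_cadjoint)

text \<open>The zero functional makes all of \<open>M\<close> a subbasic open set.\<close>

lemma Union_sigma_strong_star_subbase:
  assumes "von_neumann_algebra M"
  shows "\<Union> {{y\<in>M. sigma_strong_star_seminorm \<phi> (y - x) < \<epsilon>} | \<phi> x \<epsilon>.
        \<phi> \<in> predual M \<and> positive_functional M \<phi> \<and> x \<in> M \<and> \<epsilon> > 0} = M" (is "\<Union>?S = M")
proof -
  have 0: "(\<lambda>_. 0) \<in> predual M" "positive_functional M (\<lambda>_. 0)"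
    by (auto simp: predual_def bounded_functional_def normal_functional_def positive_functional_def
        intro: exI[of _ 0])
  have zero: "0 \<in> M" using assms by (simp add: von_neumann_algebra_def cstar_subalgebra_def)
  have "M = {y\<in>M. sigma_strong_star_seminorm (\<lambda>_. 0) (y - 0) < 1}"
    by (simp add: sigma_strong_star_seminorm_def)
  then have "M \<in> ?S" using 0 zero zero_less_one by blast
  then show ?thesis by blast
qed

text \<open>The subbasic neighbourhoods of \<open>x\<close> may be centred at a point \<open>c\<close> other than \<open>x\<close>; the weighted form of
  \<open>gns_square_add_le\<close> takes the place of the triangle inequality here.\<close>

lemma order_convergent_imp_sigma_strong_star:
  fixes M :: "('h::chilbert_space \<Rightarrow>\<^sub>L 'h) set"
  assumes M: "von_neumann_algebra M" and I: "directed_set I r" and X: "X ` I \<subseteq> M" and x: "x \<in> M"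
    and conv: "order_convergent M star_le I r X x"
  shows "limitin (sigma_strong_star_topology M) X x (net_filter I r)"
proof -
  let ?F = "net_filter I r"
  obtain Y Z where Y: "Y ` I \<subseteq> M" "monotone_on I r star_le Y" "is_supremum M star_le (Y ` I) x"
    and Z: "Z ` I \<subseteq> M" "monotone_on I r (\<lambda>a b. star_le b a) Z" "is_infimum M star_le (Z ` I) x"
    and YXZ: "\<And>i. i \<in> I \<Longrightarrow> Y i \<preceq>\<^sub>\<star> X i" "\<And>i. i \<in> I \<Longrightarrow> X i \<preceq>\<^sub>\<star> Z i"
    using conv unfolding order_convergent_def by blast
  have Yx: "Y i \<preceq>\<^sub>\<star> x" if "i \<in> I" for i using Y(3) that by (simp add: is_supremum_def)
  note ops = von_neumann_algebra_bounded_ops[OF M] and diff = von_neumann_algebra_diff[OF M]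
    and adj = von_neumann_algebra_adjoint[OF M]
  have inM: "Y i \<in> M" "X i \<in> M" "Z i \<in> M" if "i \<in> I" for i using X Y(1) Z(1) that by blast+
  note limY = star_supremum_strong_limit[OF M I Y] and limZ = star_infimum_strong_limit[OF M I Z]
  have halves: "left_star_le a b" "left_star_le (a\<^sup>\<dagger>) (b\<^sup>\<dagger>)" if "a \<in> M" "b \<in> M" "a \<preceq>\<^sub>\<star> b" for a b
    using that star_le_iff_left_star_le[OF ops ops] by blast+
  have mono: "monotone_on I r left_star_le Y" "monotone_on I r left_star_le (\<lambda>i. (Y i)\<^sup>\<dagger>)"
    "monotone_on I r (\<lambda>a b. left_star_le b a) Z" "monotone_on I r (\<lambda>a b. left_star_le b a) (\<lambda>i. (Z i)\<^sup>\<dagger>)"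
    by (rule monotone_onI, rule halves; blast intro: inM monotone_onD[OF Y(2)] monotone_onD[OF Z(2)])+
  have lim: "((\<lambda>i. gns_square \<phi> (X i - x) + gns_square \<phi> ((X i)\<^sup>\<dagger> - x\<^sup>\<dagger>)) \<longlongrightarrow> 0) ?F"
    if \<phi>: "\<phi> \<in> predual M" "positive_functional M \<phi>" for \<phi>
  proof -
    have "((\<lambda>i. gns_square \<phi> (X i - x)) \<longlongrightarrow> 0) ?F"
      by (rule gns_square_squeeze[OF M \<phi> I inM x _ _ _ mono(1) limY(1) mono(3) limZ(1)])
        (simp_all add: halves inM x YXZ Yx)
    moreover have "((\<lambda>i. gns_square \<phi> ((X i)\<^sup>\<dagger> - x\<^sup>\<dagger>)) \<longlongrightarrow> 0) ?F"
      by (rule gns_square_squeeze[OF M \<phi> I adj[OF inM(1)] adj[OF inM(2)] adj[OF inM(3)] adj[OF x]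
            _ _ _ mono(2) limY(2) mono(4) limZ(2)])
        (simp_all add: halves inM x YXZ Yx)
    ultimately show ?thesis using tendsto_add by fastforce
  qed
  show ?thesis
    unfolding sigma_strong_star_topology_def
  proof (rule limitin_topology_generated_by)
    show "x \<in> \<Union> {{y\<in>M. sigma_strong_star_seminorm \<phi> (y - x) < \<epsilon>} | \<phi> x \<epsilon>.
        \<phi> \<in> predual M \<and> positive_functional M \<phi> \<and> x \<in> M \<and> \<epsilon> > 0}"
      unfolding Union_sigma_strong_star_subbase[OF M] by (rule x)
  next
    fix U assume "U \<in> {{y\<in>M. sigma_strong_star_seminorm \<phi> (y - x) < \<epsilon>} | \<phi> x \<epsilon>.
        \<phi> \<in> predual M \<and> positive_functional M \<phi> \<and> x \<in> M \<and> \<epsilon> > 0}" and xU: "x \<in> U"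
    then obtain \<phi> c \<epsilon> where U: "U = {y\<in>M. sigma_strong_star_seminorm \<phi> (y - c) < \<epsilon>}"
      and \<phi>: "\<phi> \<in> predual M" "positive_functional M \<phi>" and c: "c \<in> M" and \<epsilon>: "\<epsilon> > 0" by blast
    have bf: "bounded_functional M \<phi>" using \<phi>(1) by (simp add: predual_def)
    define Q where "Q = (\<lambda>a. gns_square \<phi> a + gns_square \<phi> (a\<^sup>\<dagger>))"
    have Q_nonneg: "0 \<le> Q a" if "a \<in> M" for a
      using that adj gns_square_nonneg[OF \<phi>(2)] by (simp add: Q_def)
    have Q_add: "Q (a + b) \<le> (1 + t) * Q a + (1 + 1 / t) * Q b" if "a \<in> M" "b \<in> M" "0 < t" for a b t
      using gns_square_add_le[OF M bf \<phi>(2) that] gns_square_add_le[OF M bf \<phi>(2) adj adj, OF that]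
        that ops by (simp add: Q_def cadjoint_add algebra_simps)
    have in_U: "y \<in> U \<longleftrightarrow> Q (y - c) < \<epsilon>\<^sup>2" if "y \<in> M" for y
    proof -
      have "sqrt (Q (y - c)) < \<epsilon> \<longleftrightarrow> Q (y - c) < \<epsilon>\<^sup>2"
        using real_sqrt_less_iff[of "Q (y - c)" "\<epsilon>\<^sup>2"] \<epsilon> by (simp del: real_sqrt_less_iff)
      then show ?thesis
        using that by (simp add: U sigma_strong_star_seminorm_eq[OF ops[OF diff[OF that c]]] Q_def)
    qed
    have "Q (x - c) < \<epsilon>\<^sup>2" using xU in_U[OF x] by blast
    \<comment> \<open>This \<open>t\<close> makes \<open>t * Q (x - c)\<close> at most half the gap between \<open>Q (x - c)\<close> and \<open>\<epsilon>\<^sup>2\<close>; the weight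
        \<open>1 + 1 / t\<close> then falls on \<open>X i - x\<close>, which tends to \<open>0\<close>.\<close>
    define t where "t = (\<epsilon>\<^sup>2 - Q (x - c)) / (2 * (Q (x - c) + 1))"
    have t: "0 < t" "(1 + t) * Q (x - c) < \<epsilon>\<^sup>2"
    proof -
      have Q: "0 \<le> Q (x - c)" by (rule Q_nonneg[OF diff[OF x c]])
      show "0 < t" using Q \<open>Q (x - c) < \<epsilon>\<^sup>2\<close> by (simp add: t_def)
      moreover have "t * (Q (x - c) + 1) = (\<epsilon>\<^sup>2 - Q (x - c)) / 2"
        using Q by (simp add: t_def field_simps)
      ultimately show "(1 + t) * Q (x - c) < \<epsilon>\<^sup>2"
        using \<open>Q (x - c) < \<epsilon>\<^sup>2\<close> by (simp add: algebra_simps)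
    qed
    have "((\<lambda>i. (1 + t) * Q (x - c) + (1 + 1 / t) * (gns_square \<phi> (X i - x) + gns_square \<phi> ((X i)\<^sup>\<dagger> - x\<^sup>\<dagger>)))
        \<longlongrightarrow> (1 + t) * Q (x - c) + (1 + 1 / t) * 0) ?F"
      by (intro tendsto_intros lim[OF \<phi>])
    then have "\<forall>\<^sub>F i in ?F. (1 + t) * Q (x - c)
        + (1 + 1 / t) * (gns_square \<phi> (X i - x) + gns_square \<phi> ((X i)\<^sup>\<dagger> - x\<^sup>\<dagger>)) < \<epsilon>\<^sup>2"
      using t(2) by (intro order_tendstoD(2)) auto
    with eventually_in_net_filter[OF I] show "\<forall>\<^sub>F i in ?F. X i \<in> U"
    proof eventually_elim
      case (elim i)
      have "Q (X i - c) = Q ((x - c) + (X i - x))" by simp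
      also have "\<dots> \<le> (1 + t) * Q (x - c) + (1 + 1 / t) * Q (X i - x)"
        by (intro Q_add diff inM x c t elim)
      also have "Q (X i - x) = gns_square \<phi> (X i - x) + gns_square \<phi> ((X i)\<^sup>\<dagger> - x\<^sup>\<dagger>)"
        using elim(1) by (simp add: Q_def cadjoint_diff ops inM x)
      finally show ?case using elim in_U[OF inM(2)] by simp
    qed
  qed
qed

lemma topspace_order_topology:
  assumes "poset P le" shows "topspace (order_topology P le) = P"
proof
  have "closedin (order_topology P le) (topspace (order_topology P le))" by simp
  then show "topspace (order_topology P le) \<subseteq> P"
    unfolding closedin_order_topology[OF assms] order_closed_def by blast
  have "order_closed P le P" by (auto simp: order_closed_def)
  then have "closedin (order_topology P le) P" by (simp only: closedin_order_topology[OF assms])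
  then show "P \<subseteq> topspace (order_topology P le)" by (rule closedin_subset)
qed

theorem theorem4p4:
  fixes M :: "('h::chilbert_space \<Rightarrow>\<^sub>L 'h) set"
  assumes "von_neumann_algebra M"
  shows "(\<forall>(I :: 'i set) r X x.
            directed_set I r \<and> X ` I \<subseteq> M \<and> x \<in> M \<and> order_convergent M star_le I r X x \<longrightarrow>
            limitin (sigma_strong_star_topology M) X x (net_filter I r)) \<and>
         {U. openin (sigma_strong_star_topology M) U} \<subseteq> {U. openin (order_topology M star_le) U}"
proof (intro conjI subsetI)
  show "\<forall>(I :: 'i set) r X x.
            directed_set I r \<and> X ` I \<subseteq> M \<and> x \<in> M \<and> order_convergent M star_le I r X x \<longrightarrow>
            limitin (sigma_strong_star_topology M) X x (net_filter I r)"
    using order_convergent_imp_sigma_strong_star[OF assms] by blast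
  have po: "poset M star_le"
    using von_neumann_algebra_bounded_ops[OF assms] by (intro poset_star_le subsetI)
  fix U assume "U \<in> {U. openin (sigma_strong_star_topology M) U}"
  then have U: "openin (sigma_strong_star_topology M) U" by simp
  have "topspace (sigma_strong_star_topology M) = M"
    unfolding sigma_strong_star_topology_def topology_generated_by_topspace
    by (rule Union_sigma_strong_star_subbase[OF assms])
  then have UM: "U \<subseteq> M" using openin_subset[OF U] by simp
  have "order_closed M star_le (M - U)"
    unfolding order_closed_def
  proof (intro conjI notI)
    assume "\<exists>(I :: (('h \<Rightarrow>\<^sub>L 'h) \<times> ('h \<Rightarrow>\<^sub>L 'h) \<times> ('h \<Rightarrow>\<^sub>L 'h)) set) r X x. directed_set I r \<and>
        X ` I \<subseteq> M - U \<and> x \<in> M - (M - U) \<and> order_convergent M star_le I r X x"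
    then obtain I :: "(('h \<Rightarrow>\<^sub>L 'h) \<times> ('h \<Rightarrow>\<^sub>L 'h) \<times> ('h \<Rightarrow>\<^sub>L 'h)) set" and r X x
      where *: "directed_set I r" "X ` I \<subseteq> M - U" "x \<in> U" "x \<in> M" "order_convergent M star_le I r X x"
      by blast
    then have "limitin (sigma_strong_star_topology M) X x (net_filter I r)"
      by (intro order_convergent_imp_sigma_strong_star[OF assms]) auto
    then have "\<forall>\<^sub>F i in net_filter I r. X i \<in> U" using U *(3) by (simp add: limitin_def)
    with eventually_in_net_filter[OF *(1)] have "\<forall>\<^sub>F i in net_filter I r. False"
      by eventually_elim (use *(2) in blast)
    then show False using net_filter_neq_bot[OF *(1)] by (simp add: trivial_limit_def)
  qed blast
  then have "closedin (order_topology M star_le) (M - U)" by (simp only: closedin_order_topology[OF po])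
  then show "U \<in> {U. openin (order_topology M star_le) U}"
    using UM by (simp add: openin_closedin_eq topspace_order_topology[OF po])
qed

end
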